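(* Let $\mathbf{DPG}$ be the category of dynamical post-groups over $\Lambda$ and $\mathbf{BDG}$ the category of braided dynamical groups over $\Lambda$. The assignment $$\mathcal{Y}:(\mathscr{G},\{\cdot_\lambda\},\{\vartriangleright_\lambda\})\mapsto(\mathscr{G},\{\circ_\lambda\},R_G),\quad a\circ_\lambda b=a\cdot_\lambda(a\vartriangleright_\lambda b),\quad R_G(\lambda,a,b)=\Big(a\vartriangleright_\lambda b,\ \overline{(a\vartriangleright_\lambda b)}^\lambda\circ_{\phi_G(\lambda,a\vartriangleright_\lambda b)}(a\circ_\lambda b)\Big),$$ being the identity on morphisms, is a functor $\mathbf{DPG}\to\mathbf{BDG}$; the assignment $$\mathcal{P}:(\mathscr{G},\{\circ_\lambda\},R_G)\mapsto(\mathscr{G},\{\cdot_\lambda\},\{\vartriangleright_\lambda\}),\quad a\vartriangleright_\lambda b=a\rightharpoonup_\lambda b,\quad a\cdot_\lambda b=a\circ_\lambda(\bar a^\lambda\rightharpoonup_{\phi_G(\lambda,a)}b),$$ where $R_G(\lambda,a,b)=(a\rightharpoonup_\lambda b,a\leftharpoonup_\lambda b)$, being the identity on morphisms, is a functor $\mathbf{BDG}\to\mathbf{DPG}$; and $\mathcal{P}$ is the inverse of $\mathcal{Y}$, giving an isomorphism between the categories $\mathbf{DPG}$ and $\mathbf{BDG}$. Here $\bar c^\lambda$ is the inverse of $c$ with respect to $\circ_\lambda$ in the dynamical group $(\mathscr{G},\{\circ_\lambda\})$.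
   Context: Fix a set $\Lambda$. A dynamical set is a triple $\mathscr{X}=(X,\Lambda,\phi_X)$ with $X$ a set and $\phi_X:\Lambda\times X\to\Lambda$ a map. A morphism $\mathscr{X}\to\mathscr{Y}$ is a map $f:\Lambda\times X\to Y$, $f_\lambda=f(\lambda,-)$, with $\phi_Y(\lambda,f_\lambda(x))=\phi_X(\lambda,x)$; composition is $(g\circ f)_\lambda=g_\lambda\circ f_\lambda$. The tensor product is $\mathscr{X}\otimes\mathscr{Y}=(X\times Y,\Lambda,\phi_{X\times Y})$, $\phi_{X\times Y}(\lambda,x,y)=\phi_Y(\phi_X(\lambda,x),y)$. Dynamical group: a dynamical set $\mathscr{G}=(G,\Lambda,\phi_G)$ with maps $\circ_\lambda:G\times G\to G$ such that $\phi_G(\lambda,a\circ_\lambda b)=\phi_G(\phi_G(\lambda,a),b)$ and $a\circ_\lambda(b\circ_{\phi_G(\lambda,a)}c)=(a\circ_\lambda b)\circ_\lambda c$; an element $e_G$ with $a\circ_\lambda e_G=e_G\circ_\lambda a=a$ and $\phi_G(\lambda,e_G)=\lambda$; and for all $\lambda,a$ a (unique) element $\bar a^\lambda$ with $a\circ_\lambda\bar a^\lambda=\bar a^\lambda\circ_{\phi_G(\lambda,a)}a=e_G$. A homomorphism of dynamical groups $(\mathscr{G},\circ)\to(\mathscr{H},\circ')$ is a morphism of dynamical sets $\Psi$ with $\Psi_\lambda(a\circ_\lambda b)=\Psi_\lambda(a)\circ'_\lambda\Psi_{\phi_G(\lambda,a)}(b)$. A constant dynamical group is a dynamical group whose structure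 map is $(\lambda,x)\mapsto\lambda$, i.e. a family of group structures $\cdot_\lambda$ ($\lambda\in\Lambda$) on one set with a common unit; $a^\lambda$ denotes the inverse of $a$ for $\cdot_\lambda$. Dynamical post-group (objects of $\mathbf{DPG}$): a dynamical set $\mathscr{G}=(G,\Lambda,\phi_G)$ with maps $\cdot_\lambda,\vartriangleright_\lambda:G\times G\to G$ ($\lambda\in\Lambda$) such that $(G,\Lambda,\{\cdot_\lambda\})$ is a constant dynamical group, with unit $e_G$; and for all $\lambda\in\Lambda$, $a,b,c\in G$: $a\vartriangleright_\lambda(b\cdot_{\phi_G(\lambda,a)}c)=(a\vartriangleright_\lambda b)\cdot_\lambda(a\vartriangleright_\lambda c)$; $(a\cdot_\lambda(a\vartriangleright_\lambda b))\vartriangleright_\lambda c=a\vartriangleright_\lambda(b\vartriangleright_{\phi_G(\lambda,a)}c)$; and the map $L^{\rhd_\lambda}_a:b\mapsto a\vartriangleright_\lambda b$ is invertible. (For $\circ_\lambda$ obtained from a dynamical post-group, the unit is $e_G$ and $\bar a^\lambda=(L^{\rhd_\lambda}_a)^{-1}(a^\lambda)$.) Morphisms of $\mathbf{DPG}$: morphisms of dynamical sets $\Psi:\mathscr{G}\to\mathscr{H}$ with $\Psi_\lambda(a\cdot_\lambda b)=\Psi_\lambda(a)\cdot'_\lambda\Psi_\lambda(b)$ and $\Psi_\lambda(a\vartriangleright_\lambda b)=\Psi_\lambda(a)\vartriangleright'_\lambda\Psi_{\phi_G(\lambda,a)}(b)$. Braided dynamical group (objects of $\mathbf{BDG}$):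 a dynamical group $(\mathscr{G},\circ)$ with a map $\sigma:\Lambda\times G\times G\to G\times G$, $\sigma(\lambda,a,b)=(a\rightharpoonup_\lambda b,\ a\leftharpoonup_\lambda b)$, which is a morphism of dynamical sets $\mathscr{G}\otimes\mathscr{G}\to\mathscr{G}\otimes\mathscr{G}$ such that for all $\lambda\in\Lambda$, $a,b,x,y\in G$: (1) $e_G\rightharpoonup_\lambda x=x$; (2) $(a\circ_\lambda b)\rightharpoonup_\lambda x=a\rightharpoonup_\lambda(b\rightharpoonup_{\phi_G(\lambda,a)}x)$; (3) $a\rightharpoonup_\lambda(x\circ_{\phi_G(\lambda,a)}y)=(a\rightharpoonup_\lambda x)\circ_\lambda\big((a\leftharpoonup_\lambda x)\rightharpoonup_{\phi_G(\lambda,a\rightharpoonup_\lambda x)}y\big)$; (4) $a\leftharpoonup_\lambda e_G=a$; (5) $a\leftharpoonup_\lambda(x\circ_{\phi_G(\lambda,a)}y)=(a\leftharpoonup_\lambda x)\leftharpoonup_{\phi_G(\lambda,a\rightharpoonup_\lambda x)}y$; (6) $(a\circ_\lambda b)\leftharpoonup_\lambda x=\big(a\leftharpoonup_\lambda(b\rightharpoonup_{\phi_G(\lambda,a)}x)\big)\circ_{\phi_G(\lambda,(a\circ_\lambda b)\rightharpoonup_\lambda x)}(b\leftharpoonup_{\phi_G(\lambda,a)}x)$; (7) $(a\rightharpoonup_\lambda b)\circ_\lambda(a\leftharpoonup_\lambda b)=a\circ_\lambda b$. Morphisms of $\mathbf{BDG}$ from $(\mathscr{G},\sigma)$ to $(\mathscr{H},\sigma')$: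 homomorphisms of dynamical groups $\Psi$ with $(\Psi\times\Psi)_\lambda\circ\sigma_\lambda=\sigma'_\lambda\circ(\Psi\times\Psi)_\lambda$ for all $\lambda$, where $(\Psi\times\Psi)_\lambda(a,b)=(\Psi_\lambda(a),\Psi_{\phi_G(\lambda,a)}(b))$.
   Formalization: Dynamical post-groups are additionally required to satisfy φ_G(λ, a·_λ(a▷_λ b)) = φ_G(φ_G(λ,a), b) and φ_G(λ, e_G) = λ; without these, Y(G) need not be a dynamical group (e.g. G={e}, Λ={0,1}, φ_G(λ,e)=0). *)

theory Defs
  imports "HOL-Library.FuncSet"
begin

section \<open>Categories and functors\<close>

record ('o, 'm) category =
  Obj :: "'o set"
  Hom :: "'o \<Rightarrow> 'o \<Rightarrow> 'm set"
  Ident :: "'o \<Rightarrow> 'm"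
  Comp :: "'o \<Rightarrow> 'o \<Rightarrow> 'o \<Rightarrow> 'm \<Rightarrow> 'm \<Rightarrow> 'm"

text \<open>For \<open>f : X \<rightarrow> Y\<close> and \<open>g : Y \<rightarrow> Z\<close> the composite \<open>g \<circ> f\<close> is \<open>Comp C X Y Z g f\<close>. The objects are
  arguments because the same function may be an arrow between several pairs of objects.\<close>

definition is_category :: "('o, 'm) category \<Rightarrow> bool" where
  "is_category C \<longleftrightarrow>
     (\<forall>X\<in>Obj C. Ident C X \<in> Hom C X X) \<and>
     (\<forall>X\<in>Obj C. \<forall>Y\<in>Obj C. \<forall>Z\<in>Obj C. \<forall>f\<in>Hom C X Y. \<forall>g\<in>Hom C Y Z.
        Comp C X Y Z g f \<in> Hom C X Z) \<and>
     (\<forall>X\<in>Obj C. \<forall>Y\<in>Obj C. \<forall>f\<in>Hom C X Y.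
        Comp C X X Y f (Ident C X) = f \<and> Comp C X Y Y (Ident C Y) f = f) \<and>
     (\<forall>W\<in>Obj C. \<forall>X\<in>Obj C. \<forall>Y\<in>Obj C. \<forall>Z\<in>Obj C.
        \<forall>f\<in>Hom C W X. \<forall>g\<in>Hom C X Y. \<forall>h\<in>Hom C Y Z.
        Comp C W Y Z h (Comp C W X Y g f) = Comp C W X Z (Comp C X Y Z h g) f)"

record ('o, 'm, 'p, 'n) functor_data =
  on_obj :: "'o \<Rightarrow> 'p"
  on_hom :: "'o \<Rightarrow> 'o \<Rightarrow> 'm \<Rightarrow> 'n"

definition is_functor ::
  "('o, 'm) category \<Rightarrow> ('p, 'n) category \<Rightarrow> ('o, 'm, 'p, 'n) functor_data \<Rightarrow> bool" where
  "is_functor C D F \<longleftrightarrow>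
     is_category C \<and> is_category D \<and>
     (\<forall>X\<in>Obj C. on_obj F X \<in> Obj D) \<and>
     (\<forall>X\<in>Obj C. \<forall>Y\<in>Obj C. \<forall>f\<in>Hom C X Y. on_hom F X Y f \<in> Hom D (on_obj F X) (on_obj F Y)) \<and>
     (\<forall>X\<in>Obj C. on_hom F X X (Ident C X) = Ident D (on_obj F X)) \<and>
     (\<forall>X\<in>Obj C. \<forall>Y\<in>Obj C. \<forall>Z\<in>Obj C. \<forall>f\<in>Hom C X Y. \<forall>g\<in>Hom C Y Z.
        on_hom F X Z (Comp C X Y Z g f) =
        Comp D (on_obj F X) (on_obj F Y) (on_obj F Z) (on_hom F Y Z g) (on_hom F X Y f))"

text \<open>\<open>G \<circ> F\<close> is strictly equal to the identity functor of \<open>C\<close>.\<close>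

definition composes_to_identity ::
  "('o, 'm) category \<Rightarrow> ('o, 'm, 'p, 'n) functor_data \<Rightarrow> ('p, 'n, 'o, 'm) functor_data \<Rightarrow> bool" where
  "composes_to_identity C F G \<longleftrightarrow>
     (\<forall>X\<in>Obj C. on_obj G (on_obj F X) = X) \<and>
     (\<forall>X\<in>Obj C. \<forall>Y\<in>Obj C. \<forall>f\<in>Hom C X Y.
        on_hom G (on_obj F X) (on_obj F Y) (on_hom F X Y f) = f)"

definition is_category_isomorphism ::
  "('o, 'm) category \<Rightarrow> ('p, 'n) category \<Rightarrow> ('o, 'm, 'p, 'n) functor_data \<Rightarrow> bool" where
  "is_category_isomorphism C D F \<longleftrightarrow>
     is_functor C D F \<and>
     (\<exists>G. is_functor D C G \<and> composes_to_identity C F G \<and> composes_to_identity D G F)"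


section \<open>Dynamical sets\<close>

text \<open>All maps are extensional (\<open>undefined\<close> outside their domain), so that equality of records and
  of morphisms is equality of the maps between the sets in question.\<close>

record ('l, 'x) dyn_set =
  carrier :: "'x set"
  phi :: "'l \<Rightarrow> 'x \<Rightarrow> 'l"

definition dynamical_set :: "'l set \<Rightarrow> ('l, 'x, 'z) dyn_set_scheme \<Rightarrow> bool" where
  "dynamical_set \<Lambda> X \<longleftrightarrow> phi X \<in> \<Lambda> \<rightarrow>\<^sub>E carrier X \<rightarrow>\<^sub>E \<Lambda>"

definition dyn_morphism ::
  "'l set \<Rightarrow> ('l, 'x, 'z) dyn_set_scheme \<Rightarrow> ('l, 'y, 'w) dyn_set_scheme \<Rightarrow> ('l \<Rightarrow> 'x \<Rightarrow> 'y) \<Rightarrow> bool" where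
  "dyn_morphism \<Lambda> X Y f \<longleftrightarrow>
     f \<in> \<Lambda> \<rightarrow>\<^sub>E carrier X \<rightarrow>\<^sub>E carrier Y \<and>
     (\<forall>l\<in>\<Lambda>. \<forall>x\<in>carrier X. phi Y l (f l x) = phi X l x)"

definition dyn_id :: "'l set \<Rightarrow> ('l, 'x, 'z) dyn_set_scheme \<Rightarrow> 'l \<Rightarrow> 'x \<Rightarrow> 'x" where
  "dyn_id \<Lambda> X = (\<lambda>l\<in>\<Lambda>. \<lambda>x\<in>carrier X. x)"

definition dyn_comp ::
  "'l set \<Rightarrow> ('l, 'x, 'z) dyn_set_scheme \<Rightarrow> ('l \<Rightarrow> 'y \<Rightarrow> 'v) \<Rightarrow> ('l \<Rightarrow> 'x \<Rightarrow> 'y) \<Rightarrow> 'l \<Rightarrow> 'x \<Rightarrow> 'v" where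
  "dyn_comp \<Lambda> X g f = (\<lambda>l\<in>\<Lambda>. \<lambda>x\<in>carrier X. g l (f l x))"

definition dyn_tensor ::
  "'l set \<Rightarrow> ('l, 'x, 'z) dyn_set_scheme \<Rightarrow> ('l, 'y, 'w) dyn_set_scheme \<Rightarrow> ('l, 'x \<times> 'y) dyn_set" where
  "dyn_tensor \<Lambda> X Y =
     \<lparr>carrier = carrier X \<times> carrier Y,
      phi = (\<lambda>l\<in>\<Lambda>. \<lambda>(x, y)\<in>carrier X \<times> carrier Y. phi Y (phi X l x) y)\<rparr>"


section \<open>Dynamical groups\<close>

record ('l, 'g) dyn_group = "('l, 'g) dyn_set" +
  circ :: "'l \<Rightarrow> 'g \<Rightarrow> 'g \<Rightarrow> 'g"
  neutral :: 'g

definition dynamical_group :: "'l set \<Rightarrow> ('l, 'g, 'z) dyn_group_scheme \<Rightarrow> bool" where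
  "dynamical_group \<Lambda> G \<longleftrightarrow>
     dynamical_set \<Lambda> G \<and>
     circ G \<in> \<Lambda> \<rightarrow>\<^sub>E carrier G \<rightarrow>\<^sub>E carrier G \<rightarrow>\<^sub>E carrier G \<and>
     (\<forall>l\<in>\<Lambda>. \<forall>a\<in>carrier G. \<forall>b\<in>carrier G. phi G l (circ G l a b) = phi G (phi G l a) b) \<and>
     (\<forall>l\<in>\<Lambda>. \<forall>a\<in>carrier G. \<forall>b\<in>carrier G. \<forall>c\<in>carrier G.
        circ G l a (circ G (phi G l a) b c) = circ G l (circ G l a b) c) \<and>
     neutral G \<in> carrier G \<and>
     (\<forall>l\<in>\<Lambda>. \<forall>a\<in>carrier G. circ G l a (neutral G) = a \<and> circ G l (neutral G) a = a) \<and>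
     (\<forall>l\<in>\<Lambda>. phi G l (neutral G) = l) \<and>
     (\<forall>l\<in>\<Lambda>. \<forall>a\<in>carrier G. \<exists>b\<in>carrier G.
        circ G l a b = neutral G \<and> circ G (phi G l a) b a = neutral G)"

definition dyn_inv :: "('l, 'g, 'z) dyn_group_scheme \<Rightarrow> 'l \<Rightarrow> 'g \<Rightarrow> 'g" where
  "dyn_inv G l a =
     (THE b. b \<in> carrier G \<and> circ G l a b = neutral G \<and> circ G (phi G l a) b a = neutral G)"

definition dyn_group_hom ::
  "'l set \<Rightarrow> ('l, 'g, 'z) dyn_group_scheme \<Rightarrow> ('l, 'h, 'w) dyn_group_scheme \<Rightarrow>
   ('l \<Rightarrow> 'g \<Rightarrow> 'h) \<Rightarrow> bool" where
  "dyn_group_hom \<Lambda> G H f \<longleftrightarrow>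
     dyn_morphism \<Lambda> G H f \<and>
     (\<forall>l\<in>\<Lambda>. \<forall>a\<in>carrier G. \<forall>b\<in>carrier G.
        f l (circ G l a b) = circ H l (f l a) (f (phi G l a) b))"

definition constant_dynamical_group :: "'l set \<Rightarrow> ('l, 'g, 'z) dyn_group_scheme \<Rightarrow> bool" where
  "constant_dynamical_group \<Lambda> G \<longleftrightarrow>
     dynamical_group \<Lambda> G \<and> (\<forall>l\<in>\<Lambda>. \<forall>x\<in>carrier G. phi G l x = l)"


section \<open>Dynamical post-groups\<close>

record ('l, 'g) dyn_post_group = "('l, 'g) dyn_set" +
  dot :: "'l \<Rightarrow> 'g \<Rightarrow> 'g \<Rightarrow> 'g"
  rhd :: "'l \<Rightarrow> 'g \<Rightarrow> 'g \<Rightarrow> 'g"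
  unit_elt :: 'g

text \<open>\<open>(G, \<Lambda>, {\<cdot>\<^sub>\<lambda>})\<close>: the structure map \<open>phi A\<close> is replaced by the projection \<open>(\<lambda>, x) \<mapsto> \<lambda>\<close>.\<close>

definition post_group_dot :: "'l set \<Rightarrow> ('l, 'g) dyn_post_group \<Rightarrow> ('l, 'g) dyn_group" where
  "post_group_dot \<Lambda> A =
     \<lparr>carrier = carrier A, phi = (\<lambda>l\<in>\<Lambda>. \<lambda>x\<in>carrier A. l), circ = dot A, neutral = unit_elt A\<rparr>"

text \<open>The last two conjuncts relate \<open>phi A\<close> to the operations. They do not follow from the other
  conjuncts, and they say exactly that \<open>a \<circ>\<^sub>\<lambda> b = a \<cdot>\<^sub>\<lambda> (a \<rhd>\<^sub>\<lambda> b)\<close> and the unit satisfy the conditions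
  on \<open>phi\<close> in the definition of a dynamical group. Without them, take the trivial group \<open>{e}\<close>,
  \<open>\<Lambda> = {0, 1}\<close> and \<open>phi \<lambda> e = 0\<close>; or any group with the same product for all \<open>\<lambda>\<close>,
  \<open>a \<rhd>\<^sub>\<lambda> b = b\<close>, and a \<open>phi\<close> that is not a right action: then \<open>\<circ>\<close> gives no dynamical group.\<close>

definition dynamical_post_group :: "'l set \<Rightarrow> ('l, 'g) dyn_post_group \<Rightarrow> bool" where
  "dynamical_post_group \<Lambda> A \<longleftrightarrow>
     dynamical_set \<Lambda> A \<and>
     constant_dynamical_group \<Lambda> (post_group_dot \<Lambda> A) \<and>
     rhd A \<in> \<Lambda> \<rightarrow>\<^sub>E carrier A \<rightarrow>\<^sub>E carrier A \<rightarrow>\<^sub>E carrier A \<and>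
     (\<forall>l\<in>\<Lambda>. \<forall>a\<in>carrier A. \<forall>b\<in>carrier A. \<forall>c\<in>carrier A.
        rhd A l a (dot A (phi A l a) b c) = dot A l (rhd A l a b) (rhd A l a c)) \<and>
     (\<forall>l\<in>\<Lambda>. \<forall>a\<in>carrier A. \<forall>b\<in>carrier A. \<forall>c\<in>carrier A.
        rhd A l (dot A l a (rhd A l a b)) c = rhd A l a (rhd A (phi A l a) b c)) \<and>
     (\<forall>l\<in>\<Lambda>. \<forall>a\<in>carrier A. bij_betw (rhd A l a) (carrier A) (carrier A)) \<and>
     (\<forall>l\<in>\<Lambda>. \<forall>a\<in>carrier A. \<forall>b\<in>carrier A.
        phi A l (dot A l a (rhd A l a b)) = phi A (phi A l a) b) \<and>
     (\<forall>l\<in>\<Lambda>. phi A l (unit_elt A) = l)"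

definition post_group_hom ::
  "'l set \<Rightarrow> ('l, 'g) dyn_post_group \<Rightarrow> ('l, 'h) dyn_post_group \<Rightarrow> ('l \<Rightarrow> 'g \<Rightarrow> 'h) \<Rightarrow> bool" where
  "post_group_hom \<Lambda> A B f \<longleftrightarrow>
     dyn_morphism \<Lambda> A B f \<and>
     (\<forall>l\<in>\<Lambda>. \<forall>a\<in>carrier A. \<forall>b\<in>carrier A.
        f l (dot A l a b) = dot B l (f l a) (f l b) \<and>
        f l (rhd A l a b) = rhd B l (f l a) (f (phi A l a) b))"

definition DPG :: "'l set \<Rightarrow> (('l, 'g) dyn_post_group, 'l \<Rightarrow> 'g \<Rightarrow> 'g) category" where
  "DPG \<Lambda> =
     \<lparr>Obj = {A. dynamical_post_group \<Lambda> A},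
      Hom = (\<lambda>A B. {f. post_group_hom \<Lambda> A B f}),
      Ident = (\<lambda>A. dyn_id \<Lambda> A),
      Comp = (\<lambda>A B C g f. dyn_comp \<Lambda> A g f)\<rparr>"


section \<open>Braided dynamical groups\<close>

record ('l, 'g) braided_dyn_group = "('l, 'g) dyn_group" +
  braid :: "'l \<Rightarrow> 'g \<times> 'g \<Rightarrow> 'g \<times> 'g"

text \<open>\<open>lact G \<lambda> a b\<close> is \<open>a \<rightharpoonup>\<^sub>\<lambda> b\<close> and \<open>ract G \<lambda> a b\<close> is \<open>a \<leftharpoonup>\<^sub>\<lambda> b\<close>.\<close>

definition lact :: "('l, 'g) braided_dyn_group \<Rightarrow> 'l \<Rightarrow> 'g \<Rightarrow> 'g \<Rightarrow> 'g" where
  "lact G l a b = fst (braid G l (a, b))"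

definition ract :: "('l, 'g) braided_dyn_group \<Rightarrow> 'l \<Rightarrow> 'g \<Rightarrow> 'g \<Rightarrow> 'g" where
  "ract G l a b = snd (braid G l (a, b))"

definition braided_dynamical_group :: "'l set \<Rightarrow> ('l, 'g) braided_dyn_group \<Rightarrow> bool" where
  "braided_dynamical_group \<Lambda> G \<longleftrightarrow>
     dynamical_group \<Lambda> G \<and>
     dyn_morphism \<Lambda> (dyn_tensor \<Lambda> G G) (dyn_tensor \<Lambda> G G) (braid G) \<and>
     (\<forall>l\<in>\<Lambda>. \<forall>a\<in>carrier G. \<forall>b\<in>carrier G. \<forall>x\<in>carrier G. \<forall>y\<in>carrier G.
        lact G l (neutral G) x = x \<and>
        lact G l (circ G l a b) x = lact G l a (lact G (phi G l a) b x) \<and>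
        lact G l a (circ G (phi G l a) x y) =
          circ G l (lact G l a x) (lact G (phi G l (lact G l a x)) (ract G l a x) y) \<and>
        ract G l a (neutral G) = a \<and>
        ract G l a (circ G (phi G l a) x y) =
          ract G (phi G l (lact G l a x)) (ract G l a x) y \<and>
        ract G l (circ G l a b) x =
          circ G (phi G l (lact G l (circ G l a b) x))
            (ract G l a (lact G (phi G l a) b x)) (ract G (phi G l a) b x) \<and>
        circ G l (lact G l a b) (ract G l a b) = circ G l a b)"

text \<open>The map \<open>(\<Psi> \<times> \<Psi>)\<^sub>\<lambda>\<close>, with the second factor taken at the shifted parameter.\<close>

definition hom_square ::
  "('l, 'g, 'z) dyn_set_scheme \<Rightarrow> ('l \<Rightarrow> 'g \<Rightarrow> 'h) \<Rightarrow> 'l \<Rightarrow> 'g \<times> 'g \<Rightarrow> 'h \<times> 'h" where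
  "hom_square G f l = (\<lambda>(a, b). (f l a, f (phi G l a) b))"

definition braided_group_hom ::
  "'l set \<Rightarrow> ('l, 'g) braided_dyn_group \<Rightarrow> ('l, 'h) braided_dyn_group \<Rightarrow> ('l \<Rightarrow> 'g \<Rightarrow> 'h) \<Rightarrow> bool" where
  "braided_group_hom \<Lambda> G H f \<longleftrightarrow>
     dyn_group_hom \<Lambda> G H f \<and>
     (\<forall>l\<in>\<Lambda>. \<forall>p\<in>carrier G \<times> carrier G.
        hom_square G f l (braid G l p) = braid H l (hom_square G f l p))"

definition BDG :: "'l set \<Rightarrow> (('l, 'g) braided_dyn_group, 'l \<Rightarrow> 'g \<Rightarrow> 'g) category" where
  "BDG \<Lambda> =
     \<lparr>Obj = {G. braided_dynamical_group \<Lambda> G},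
      Hom = (\<lambda>G H. {f. braided_group_hom \<Lambda> G H f}),
      Ident = (\<lambda>G. dyn_id \<Lambda> G),
      Comp = (\<lambda>G H K g f. dyn_comp \<Lambda> G g f)\<rparr>"


section \<open>The two functors\<close>

definition subadjacent :: "'l set \<Rightarrow> ('l, 'g) dyn_post_group \<Rightarrow> ('l, 'g) dyn_group" where
  "subadjacent \<Lambda> A =
     \<lparr>carrier = carrier A, phi = phi A,
      circ = (\<lambda>l\<in>\<Lambda>. \<lambda>a\<in>carrier A. \<lambda>b\<in>carrier A. dot A l a (rhd A l a b)),
      neutral = unit_elt A\<rparr>"

definition post_to_braided :: "'l set \<Rightarrow> ('l, 'g) dyn_post_group \<Rightarrow> ('l, 'g) braided_dyn_group" where
  "post_to_braided \<Lambda> A =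
     (let S = subadjacent \<Lambda> A in
      \<lparr>carrier = carrier S, phi = phi S, circ = circ S, neutral = neutral S,
       braid = (\<lambda>l\<in>\<Lambda>. \<lambda>(a, b)\<in>carrier A \<times> carrier A.
         (rhd A l a b,
          circ S (phi A l (rhd A l a b)) (dyn_inv S l (rhd A l a b)) (circ S l a b)))\<rparr>)"

definition braided_to_post :: "'l set \<Rightarrow> ('l, 'g) braided_dyn_group \<Rightarrow> ('l, 'g) dyn_post_group" where
  "braided_to_post \<Lambda> G =
     \<lparr>carrier = carrier G, phi = phi G,
      dot = (\<lambda>l\<in>\<Lambda>. \<lambda>a\<in>carrier G. \<lambda>b\<in>carrier G.
        circ G l a (lact G (phi G l a) (dyn_inv G l a) b)),
      rhd = (\<lambda>l\<in>\<Lambda>. \<lambda>a\<in>carrier G. \<lambda>b\<in>carrier G. lact G l a b),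
      unit_elt = neutral G\<rparr>"

definition functor_Y ::
  "'l set \<Rightarrow> (('l, 'g) dyn_post_group, 'l \<Rightarrow> 'g \<Rightarrow> 'g,
             ('l, 'g) braided_dyn_group, 'l \<Rightarrow> 'g \<Rightarrow> 'g) functor_data" where
  "functor_Y \<Lambda> = \<lparr>on_obj = post_to_braided \<Lambda>, on_hom = (\<lambda>A B f. f)\<rparr>"

definition functor_P ::
  "'l set \<Rightarrow> (('l, 'g) braided_dyn_group, 'l \<Rightarrow> 'g \<Rightarrow> 'g,
             ('l, 'g) dyn_post_group, 'l \<Rightarrow> 'g \<Rightarrow> 'g) functor_data" where
  "functor_P \<Lambda> = \<lparr>on_obj = braided_to_post \<Lambda>, on_hom = (\<lambda>G H f. f)\<rparr>"

end

theory Submission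
  imports Defs
begin

text \<open>With \<open>a \<circ>\<^sub>\<lambda> b = a \<cdot>\<^sub>\<lambda> (a \<rhd>\<^sub>\<lambda> b)\<close> and \<open>\<rhd> = \<rightharpoonup>\<close>, either product determines the other because
  \<open>a \<rhd>\<^sub>\<lambda> -\<close> is a bijection, and condition (7) together with left cancellation determines \<open>\<leftharpoonup>\<close>.
  Conditions (5) and (6) follow from (2), (3) and (7) by cancellation. Conversely, every element
  can be written as \<open>a \<rhd>\<^sub>\<lambda> b\<close>, so identities for \<open>\<cdot>\<^sub>\<lambda>\<close> turn into identities for \<open>\<circ>\<^sub>\<lambda>\<close>. The one
  delicate point is \<open>a \<rightharpoonup>\<^sub>\<lambda> e = e\<close>, as right cancellation is only available at a fixed source.\<close>

section \<open>Dynamical groups\<close>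

locale dyn_grp =
  fixes \<Lambda> :: "'l set" and G :: "('l, 'g, 'z) dyn_group_scheme" (structure)
  assumes dynamical_group: "dynamical_group \<Lambda> G"
begin

abbreviation shift :: "'l \<Rightarrow> 'g \<Rightarrow> 'l" (infixl "\<star>" 75)
  where "l \<star> a \<equiv> phi G l a"

abbreviation circ_at :: "'g \<Rightarrow> 'l \<Rightarrow> 'g \<Rightarrow> 'g" ("(_ \<circ>\<^bsub>_\<^esub> _)" [71, 0, 70] 70)
  where "a \<circ>\<^bsub>l\<^esub> b \<equiv> circ G l a b"

abbreviation unit_at :: 'g ("\<e>") where "\<e> \<equiv> neutral G"

lemma shift_closed [simp, intro]:
  "\<lbrakk>l \<in> \<Lambda>; a \<in> carrier G\<rbrakk> \<Longrightarrow> l \<star> a \<in> \<Lambda>"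
  using dynamical_group unfolding dynamical_group_def dynamical_set_def by (auto simp: PiE_iff)

lemma circ_closed [simp, intro]:
  "\<lbrakk>l \<in> \<Lambda>; a \<in> carrier G; b \<in> carrier G\<rbrakk> \<Longrightarrow> a \<circ>\<^bsub>l\<^esub> b \<in> carrier G"
  using dynamical_group unfolding dynamical_group_def by (auto simp: PiE_iff)

lemma neutral_closed [simp, intro]: "\<e> \<in> carrier G"
  using dynamical_group unfolding dynamical_group_def by auto

lemma shift_circ [simp]:
  "\<lbrakk>l \<in> \<Lambda>; a \<in> carrier G; b \<in> carrier G\<rbrakk> \<Longrightarrow> l \<star> (a \<circ>\<^bsub>l\<^esub> b) = l \<star> a \<star> b"
  using dynamical_group unfolding dynamical_group_def by auto

lemma shift_neutral [simp]: "l \<in> \<Lambda> \<Longrightarrow> l \<star> \<e> = l"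
  using dynamical_group unfolding dynamical_group_def by auto

lemma circ_neutral [simp]:
  "\<lbrakk>l \<in> \<Lambda>; a \<in> carrier G\<rbrakk> \<Longrightarrow> a \<circ>\<^bsub>l\<^esub> \<e> = a"
  "\<lbrakk>l \<in> \<Lambda>; a \<in> carrier G\<rbrakk> \<Longrightarrow> \<e> \<circ>\<^bsub>l\<^esub> a = a"
  using dynamical_group unfolding dynamical_group_def by auto

lemma circ_assoc:
  "\<lbrakk>l \<in> \<Lambda>; a \<in> carrier G; b \<in> carrier G; c \<in> carrier G\<rbrakk> \<Longrightarrow>
   (a \<circ>\<^bsub>l\<^esub> b) \<circ>\<^bsub>l\<^esub> c = a \<circ>\<^bsub>l\<^esub> (b \<circ>\<^bsub>l \<star> a\<^esub> c)"
  using dynamical_group unfolding dynamical_group_def by auto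

lemma inverse_exists:
  assumes "l \<in> \<Lambda>" "a \<in> carrier G"
  obtains b where "b \<in> carrier G" "a \<circ>\<^bsub>l\<^esub> b = \<e>" "b \<circ>\<^bsub>l \<star> a\<^esub> a = \<e>"
  using dynamical_group assms unfolding dynamical_group_def by blast

text \<open>The inverse \<open>i\<close> of \<open>a\<close> lives at \<open>l \<star> a\<close> and
  leads back to \<open>l\<close>, so \<open>i\<close> times \<open>a \<circ> x\<close> reassociates
  to \<open>x\<close>. Cancelling on the right would involve inverses of \<open>a\<close> at two
  possibly different parameters.\<close>

lemma circ_left_cancel:
  assumes "l \<in> \<Lambda>" "a \<in> carrier G" "b \<in> carrier G" "c \<in> carrier G"
    and eq: "a \<circ>\<^bsub>l\<^esub> b = a \<circ>\<^bsub>l\<^esub> c"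
  shows "b = c"
proof -
  obtain i where i: "i \<in> carrier G" "a \<circ>\<^bsub>l\<^esub> i = \<e>" "i \<circ>\<^bsub>l \<star> a\<^esub> a = \<e>"
    using inverse_exists assms by blast
  have shift_back: "l \<star> a \<star> i = l"
    using shift_circ[of l a i] i assms by simp
  have "i \<circ>\<^bsub>l \<star> a\<^esub> (a \<circ>\<^bsub>l\<^esub> x) = x" if "x \<in> carrier G" for x
    using circ_assoc[of "l \<star> a" i a x] i assms that shift_back by simp
  then show ?thesis
    using assms by metis
qed

lemma dyn_inv:
  assumes "l \<in> \<Lambda>" "a \<in> carrier G"
  shows dyn_inv_closed [simp, intro]: "dyn_inv G l a \<in> carrier G"
    and circ_dyn_inv [simp]: "a \<circ>\<^bsub>l\<^esub> dyn_inv G l a = \<e>"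
    and dyn_inv_circ [simp]: "dyn_inv G l a \<circ>\<^bsub>l \<star> a\<^esub> a = \<e>"
proof -
  \<comment> \<open>Left cancellation gives uniqueness, so the description in \<open>dyn_inv\<close>
    is well defined.\<close>
  have "\<exists>!b. b \<in> carrier G \<and> a \<circ>\<^bsub>l\<^esub> b = \<e> \<and> b \<circ>\<^bsub>l \<star> a\<^esub> a = \<e>"
    using inverse_exists[OF assms] circ_left_cancel[OF assms] by metis
  from theI'[OF this]
  show "dyn_inv G l a \<in> carrier G" "a \<circ>\<^bsub>l\<^esub> dyn_inv G l a = \<e>"
    "dyn_inv G l a \<circ>\<^bsub>l \<star> a\<^esub> a = \<e>"
    unfolding dyn_inv_def by auto
qed

lemma shift_dyn_inv [simp]:
  "\<lbrakk>l \<in> \<Lambda>; a \<in> carrier G\<rbrakk> \<Longrightarrow> l \<star> a \<star> dyn_inv G l a = l"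
  using shift_circ[of l a "dyn_inv G l a"] by simp

lemma circ_dyn_inv_cancel [simp]:
  "\<lbrakk>l \<in> \<Lambda>; a \<in> carrier G; b \<in> carrier G\<rbrakk> \<Longrightarrow> a \<circ>\<^bsub>l\<^esub> (dyn_inv G l a \<circ>\<^bsub>l \<star> a\<^esub> b) = b"
  using circ_assoc[of l a "dyn_inv G l a" b] by simp

lemma dyn_inv_circ_cancel [simp]:
  assumes "l \<in> \<Lambda>" "a \<in> carrier G" "b \<in> carrier G"
  shows "dyn_inv G l a \<circ>\<^bsub>l \<star> a\<^esub> (a \<circ>\<^bsub>l\<^esub> b) = b"
  using circ_assoc[of "l \<star> a" "dyn_inv G l a" a b] assms by simp

end

text \<open>A right inverse \<open>b\<close> of \<open>a\<close> has in turn a right inverse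
  \<open>c\<close> at \<open>phi G l a\<close>, and
  \<open>a = a \<circ> (b \<circ> c) = (a \<circ> b) \<circ> c = c\<close>; hence \<open>b\<close>
  is two-sided. This serves both the \<open>\<circ>\<close> built from a post-group and the
  \<open>\<cdot>\<close> built from a braided group.\<close>

lemma dynamical_group_if_right_inverses:
  assumes set: "dynamical_set \<Lambda> G"
    and closed: "circ G \<in> \<Lambda> \<rightarrow>\<^sub>E carrier G \<rightarrow>\<^sub>E carrier G \<rightarrow>\<^sub>E carrier G"
    and shift: "\<And>l a b. \<lbrakk>l \<in> \<Lambda>; a \<in> carrier G; b \<in> carrier G\<rbrakk> \<Longrightarrow>
      phi G l (circ G l a b) = phi G (phi G l a) b"
    and assoc: "\<And>l a b c. \<lbrakk>l \<in> \<Lambda>; a \<in> carrier G; b \<in> carrier G; c \<in> carrier G\<rbrakk> \<Longrightarrow>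
      circ G l a (circ G (phi G l a) b c) = circ G l (circ G l a b) c"
    and unit: "neutral G \<in> carrier G"
      "\<And>l a. \<lbrakk>l \<in> \<Lambda>; a \<in> carrier G\<rbrakk> \<Longrightarrow> circ G l a (neutral G) = a"
      "\<And>l a. \<lbrakk>l \<in> \<Lambda>; a \<in> carrier G\<rbrakk> \<Longrightarrow> circ G l (neutral G) a = a"
      "\<And>l. l \<in> \<Lambda> \<Longrightarrow> phi G l (neutral G) = l"
    and right_inverse: "\<And>l a. \<lbrakk>l \<in> \<Lambda>; a \<in> carrier G\<rbrakk> \<Longrightarrow>
      \<exists>b\<in>carrier G. circ G l a b = neutral G"
  shows "dynamical_group \<Lambda> G"
proof -
  have inverse: "\<exists>b\<in>carrier G. circ G l a b = neutral G \<and> circ G (phi G l a) b a = neutral G"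
    if l: "l \<in> \<Lambda>" and a: "a \<in> carrier G" for l a
  proof -
    have la: "phi G l a \<in> \<Lambda>"
      using set l a unfolding dynamical_set_def by (auto simp: PiE_iff)
    obtain b where b: "b \<in> carrier G" "circ G l a b = neutral G"
      using right_inverse l a by blast
    obtain c where c: "c \<in> carrier G" "circ G (phi G l a) b c = neutral G"
      using right_inverse la b by blast
    have "c = a"
      using assoc[OF l a b(1) c(1)] b c unit l a by simp
    then show ?thesis
      using b c by blast
  qed
  show ?thesis
    unfolding dynamical_group_def
    by (intro conjI ballI) (simp_all add: assms(1-8) inverse)
qed

section \<open>From dynamical post-groups to braided dynamical groups\<close>

locale post_grp =
  fixes \<Lambda> :: "'l set" and A :: "('l, 'g) dyn_post_group"
  assumes dynamical_post_group: "dynamical_post_group \<Lambda> A"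
begin

abbreviation shift :: "'l \<Rightarrow> 'g \<Rightarrow> 'l" (infixl "\<star>" 75)
  where "l \<star> a \<equiv> phi A l a"

abbreviation dot_at :: "'g \<Rightarrow> 'l \<Rightarrow> 'g \<Rightarrow> 'g" ("(_ \<cdot>\<^bsub>_\<^esub> _)" [71, 0, 70] 70)
  where "a \<cdot>\<^bsub>l\<^esub> b \<equiv> dot A l a b"

abbreviation rhd_at :: "'g \<Rightarrow> 'l \<Rightarrow> 'g \<Rightarrow> 'g" ("(_ \<rhd>\<^bsub>_\<^esub> _)" [73, 0, 72] 72)
  where "a \<rhd>\<^bsub>l\<^esub> b \<equiv> rhd A l a b"

abbreviation S where "S \<equiv> subadjacent \<Lambda> A"

lemma dynamical_set: "dynamical_set \<Lambda> A"
  using dynamical_post_group unfolding dynamical_post_group_def by auto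

lemma shift_closed [simp, intro]:
  "\<lbrakk>l \<in> \<Lambda>; a \<in> carrier A\<rbrakk> \<Longrightarrow> l \<star> a \<in> \<Lambda>"
  using dynamical_set unfolding dynamical_set_def by (auto simp: PiE_iff)

lemma dot_group: "dynamical_group \<Lambda> (post_group_dot \<Lambda> A)"
  using dynamical_post_group
  unfolding dynamical_post_group_def constant_dynamical_group_def by auto

lemma dot_extensional: "dot A \<in> \<Lambda> \<rightarrow>\<^sub>E carrier A \<rightarrow>\<^sub>E carrier A \<rightarrow>\<^sub>E carrier A"
  using dot_group unfolding dynamical_group_def post_group_dot_def by simp

lemma rhd_extensional: "rhd A \<in> \<Lambda> \<rightarrow>\<^sub>E carrier A \<rightarrow>\<^sub>E carrier A \<rightarrow>\<^sub>E carrier A"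
  using dynamical_post_group unfolding dynamical_post_group_def by auto

lemma dot_closed [simp, intro]:
  "\<lbrakk>l \<in> \<Lambda>; a \<in> carrier A; b \<in> carrier A\<rbrakk> \<Longrightarrow> a \<cdot>\<^bsub>l\<^esub> b \<in> carrier A"
  using dot_extensional by (auto simp: PiE_iff)

lemma rhd_closed [simp, intro]:
  "\<lbrakk>l \<in> \<Lambda>; a \<in> carrier A; b \<in> carrier A\<rbrakk> \<Longrightarrow> a \<rhd>\<^bsub>l\<^esub> b \<in> carrier A"
  using rhd_extensional by (auto simp: PiE_iff)

lemma unit_closed [simp, intro]: "unit_elt A \<in> carrier A"
  using dot_group unfolding dynamical_group_def post_group_dot_def by simp

lemma dot_unit [simp]:
  "\<lbrakk>l \<in> \<Lambda>; a \<in> carrier A\<rbrakk> \<Longrightarrow> a \<cdot>\<^bsub>l\<^esub> unit_elt A = a"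
  "\<lbrakk>l \<in> \<Lambda>; a \<in> carrier A\<rbrakk> \<Longrightarrow> unit_elt A \<cdot>\<^bsub>l\<^esub> a = a"
  using dot_group unfolding dynamical_group_def post_group_dot_def by auto

lemma dot_assoc:
  "\<lbrakk>l \<in> \<Lambda>; a \<in> carrier A; b \<in> carrier A; c \<in> carrier A\<rbrakk> \<Longrightarrow>
   (a \<cdot>\<^bsub>l\<^esub> b) \<cdot>\<^bsub>l\<^esub> c = a \<cdot>\<^bsub>l\<^esub> (b \<cdot>\<^bsub>l\<^esub> c)"
  using dot_group unfolding dynamical_group_def post_group_dot_def by simp

lemma dot_left_cancel:
  "\<lbrakk>l \<in> \<Lambda>; a \<in> carrier A; b \<in> carrier A; c \<in> carrier A; a \<cdot>\<^bsub>l\<^esub> b = a \<cdot>\<^bsub>l\<^esub> c\<rbrakk> \<Longrightarrow> b = c"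
  using dyn_grp.circ_left_cancel[of \<Lambda> "post_group_dot \<Lambda> A" l a b c] dot_group
  by (simp add: dyn_grp_def post_group_dot_def)

lemma dot_right_inverse:
  "\<lbrakk>l \<in> \<Lambda>; a \<in> carrier A\<rbrakk> \<Longrightarrow> \<exists>b\<in>carrier A. a \<cdot>\<^bsub>l\<^esub> b = unit_elt A"
  using dot_group unfolding dynamical_group_def post_group_dot_def by simp blast

lemma rhd_dot:
  "\<lbrakk>l \<in> \<Lambda>; a \<in> carrier A; b \<in> carrier A; c \<in> carrier A\<rbrakk> \<Longrightarrow>
   a \<rhd>\<^bsub>l\<^esub> (b \<cdot>\<^bsub>l \<star> a\<^esub> c) = (a \<rhd>\<^bsub>l\<^esub> b) \<cdot>\<^bsub>l\<^esub> (a \<rhd>\<^bsub>l\<^esub> c)"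
  using dynamical_post_group unfolding dynamical_post_group_def by auto

lemma rhd_rhd:
  "\<lbrakk>l \<in> \<Lambda>; a \<in> carrier A; b \<in> carrier A; c \<in> carrier A\<rbrakk> \<Longrightarrow>
   (a \<cdot>\<^bsub>l\<^esub> (a \<rhd>\<^bsub>l\<^esub> b)) \<rhd>\<^bsub>l\<^esub> c = a \<rhd>\<^bsub>l\<^esub> (b \<rhd>\<^bsub>l \<star> a\<^esub> c)"
  using dynamical_post_group unfolding dynamical_post_group_def by auto

lemma bij_rhd: "\<lbrakk>l \<in> \<Lambda>; a \<in> carrier A\<rbrakk> \<Longrightarrow> bij_betw (rhd A l a) (carrier A) (carrier A)"
  using dynamical_post_group unfolding dynamical_post_group_def by auto

lemma shift_circ:
  "\<lbrakk>l \<in> \<Lambda>; a \<in> carrier A; b \<in> carrier A\<rbrakk> \<Longrightarrow> l \<star> (a \<cdot>\<^bsub>l\<^esub> (a \<rhd>\<^bsub>l\<^esub> b)) = l \<star> a \<star> b"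
  using dynamical_post_group unfolding dynamical_post_group_def by auto

lemma shift_unit [simp]: "l \<in> \<Lambda> \<Longrightarrow> l \<star> unit_elt A = l"
  using dynamical_post_group unfolding dynamical_post_group_def by auto

text \<open>Distributivity sends the idempotent unit to an idempotent of the group
  \<open>\<cdot>\<close> at \<open>l\<close>, and the unit is the only one.\<close>

lemma rhd_unit [simp]:
  assumes "l \<in> \<Lambda>" "a \<in> carrier A"
  shows "a \<rhd>\<^bsub>l\<^esub> unit_elt A = unit_elt A"
  using dot_left_cancel[of l "a \<rhd>\<^bsub>l\<^esub> unit_elt A" "a \<rhd>\<^bsub>l\<^esub> unit_elt A" "unit_elt A"]
    rhd_dot[of l a "unit_elt A" "unit_elt A"] assms by simp

text \<open>Weighted associativity at the unit makes \<open>unit_elt A \<rhd> -\<close> an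
  idempotent map; being injective, it is the identity.\<close>

lemma unit_rhd [simp]:
  assumes "l \<in> \<Lambda>" "a \<in> carrier A"
  shows "unit_elt A \<rhd>\<^bsub>l\<^esub> a = a"
  using rhd_rhd[of l "unit_elt A" "unit_elt A" a] bij_rhd[of l "unit_elt A"] assms
  by (auto simp: bij_betw_def inj_on_def)

section \<open>The sub-adjacent dynamical group\<close>

lemma subadjacent_simps [simp]:
  "carrier S = carrier A" "phi S = phi A" "neutral S = unit_elt A"
  by (simp_all add: subadjacent_def)

lemma circ_subadjacent:
  "\<lbrakk>l \<in> \<Lambda>; a \<in> carrier A; b \<in> carrier A\<rbrakk> \<Longrightarrow> circ S l a b = a \<cdot>\<^bsub>l\<^esub> (a \<rhd>\<^bsub>l\<^esub> b)"
  by (simp add: subadjacent_def)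

lemma subadjacent_group: "dynamical_group \<Lambda> S"
proof (rule dynamical_group_if_right_inverses)
  show "dynamical_set \<Lambda> S"
    using dynamical_set by (simp add: dynamical_set_def)
  show "circ S \<in> \<Lambda> \<rightarrow>\<^sub>E carrier S \<rightarrow>\<^sub>E carrier S \<rightarrow>\<^sub>E carrier S"
    by (auto simp: subadjacent_def)
next
  fix l a b c assume "l \<in> \<Lambda>" "a \<in> carrier S" "b \<in> carrier S" "c \<in> carrier S"
  \<comment> \<open>Both sides expand to
    \<open>a \<cdot> (a \<rhd> b) \<cdot> (a \<rhd> (b \<rhd> c))\<close>.\<close>
  then show "circ S l a (circ S (phi S l a) b c) = circ S l (circ S l a b) c"
    by (simp add: circ_subadjacent rhd_dot rhd_rhd dot_assoc)
next
  fix l a assume l: "l \<in> \<Lambda>" and a: "a \<in> carrier S"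
  then obtain b where b: "b \<in> carrier A" "a \<cdot>\<^bsub>l\<^esub> b = unit_elt A"
    using dot_right_inverse by auto
  \<comment> \<open>The right inverse for \<open>\<circ>\<close> is the preimage of the
    \<open>\<cdot>\<close>-inverse of \<open>a\<close> under \<open>a \<rhd> -\<close>.\<close>
  with l a obtain d where "d \<in> carrier A" "b = a \<rhd>\<^bsub>l\<^esub> d"
    using bij_rhd[of l a] by (auto simp: bij_betw_def)
  with b l a show "\<exists>b\<in>carrier S. circ S l a b = neutral S"
    by (auto simp: circ_subadjacent)
qed (auto simp: circ_subadjacent shift_circ)

sublocale S: dyn_grp \<Lambda> S
  by (rule dyn_grp.intro, rule subadjacent_group)

text \<open>Weighted associativity in the form of braided condition (2).\<close>

lemma rhd_circ:
  "\<lbrakk>l \<in> \<Lambda>; a \<in> carrier A; b \<in> carrier A; c \<in> carrier A\<rbrakk> \<Longrightarrow>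
   circ S l a b \<rhd>\<^bsub>l\<^esub> c = a \<rhd>\<^bsub>l\<^esub> (b \<rhd>\<^bsub>l \<star> a\<^esub> c)"
  by (simp add: circ_subadjacent rhd_rhd)

section \<open>The braiding of a post-group\<close>

abbreviation B where "B \<equiv> post_to_braided \<Lambda> A"

lemma post_to_braided_simps [simp]:
  "carrier B = carrier A" "phi B = phi A" "neutral B = unit_elt A" "circ B = circ S"
  by (simp_all add: post_to_braided_def Let_def)

lemma dynamical_group_B: "dynamical_group \<Lambda> B"
  using subadjacent_group by (simp add: dynamical_group_def dynamical_set_def)

lemma dyn_inv_B: "dyn_inv B = dyn_inv S"
  by (intro ext) (simp add: dyn_inv_def)

lemma braid_B:
  "\<lbrakk>l \<in> \<Lambda>; a \<in> carrier A; b \<in> carrier A\<rbrakk> \<Longrightarrow> braid B l (a, b) =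
    (a \<rhd>\<^bsub>l\<^esub> b, circ S (l \<star> (a \<rhd>\<^bsub>l\<^esub> b)) (dyn_inv S l (a \<rhd>\<^bsub>l\<^esub> b)) (circ S l a b))"
  by (simp add: post_to_braided_def Let_def)

lemma lact_B [simp]:
  "\<lbrakk>l \<in> \<Lambda>; a \<in> carrier A; b \<in> carrier A\<rbrakk> \<Longrightarrow> lact B l a b = a \<rhd>\<^bsub>l\<^esub> b"
  by (simp add: lact_def braid_B)

lemma ract_B:
  "\<lbrakk>l \<in> \<Lambda>; a \<in> carrier A; b \<in> carrier A\<rbrakk> \<Longrightarrow> ract B l a b =
    circ S (l \<star> (a \<rhd>\<^bsub>l\<^esub> b)) (dyn_inv S l (a \<rhd>\<^bsub>l\<^esub> b)) (circ S l a b)"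
  by (simp add: ract_def braid_B)

lemma S_closed [simp, intro]:
  "\<lbrakk>l \<in> \<Lambda>; a \<in> carrier A; b \<in> carrier A\<rbrakk> \<Longrightarrow> circ S l a b \<in> carrier A"
  "\<lbrakk>l \<in> \<Lambda>; a \<in> carrier A\<rbrakk> \<Longrightarrow> dyn_inv S l a \<in> carrier A"
  using S.circ_closed S.dyn_inv_closed by simp_all

lemma shift_S [simp]:
  "\<lbrakk>l \<in> \<Lambda>; a \<in> carrier A; b \<in> carrier A\<rbrakk> \<Longrightarrow> l \<star> circ S l a b = l \<star> a \<star> b"
  "\<lbrakk>l \<in> \<Lambda>; a \<in> carrier A\<rbrakk> \<Longrightarrow> l \<star> a \<star> dyn_inv S l a = l"
  using S.shift_circ S.shift_dyn_inv by simp_all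

lemma ract_B_closed [simp, intro]:
  "\<lbrakk>l \<in> \<Lambda>; a \<in> carrier A; b \<in> carrier A\<rbrakk> \<Longrightarrow> ract B l a b \<in> carrier A"
  by (simp add: ract_B)

text \<open>The right action was defined as the quotient of \<open>a \<circ> b\<close> by
  \<open>a \<rhd> b\<close>, which is condition (7).\<close>

lemma circ_ract_B:
  "\<lbrakk>l \<in> \<Lambda>; a \<in> carrier A; b \<in> carrier A\<rbrakk> \<Longrightarrow>
   circ S l (a \<rhd>\<^bsub>l\<^esub> b) (ract B l a b) = circ S l a b"
  using S.circ_dyn_inv_cancel[of l "a \<rhd>\<^bsub>l\<^esub> b" "circ S l a b"] by (simp add: ract_B)

text \<open>Applying the structure map to condition (7) gives the morphism property of the
  braiding.\<close>

lemma shift_ract_B: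
  assumes "l \<in> \<Lambda>" "a \<in> carrier A" "b \<in> carrier A"
  shows "l \<star> (a \<rhd>\<^bsub>l\<^esub> b) \<star> ract B l a b = l \<star> a \<star> b"
  using shift_S(1)[of l "a \<rhd>\<^bsub>l\<^esub> b" "ract B l a b"] assms by (simp add: circ_ract_B)

text \<open>By left cancellation, condition (7) characterises the right action; conditions (4), (5)
  and (6) are proved by this criterion.\<close>

lemma ract_B_eqI:
  assumes "l \<in> \<Lambda>" "a \<in> carrier A" "b \<in> carrier A" "r \<in> carrier A"
    and "circ S l (a \<rhd>\<^bsub>l\<^esub> b) r = circ S l a b"
  shows "ract B l a b = r"
  using S.circ_left_cancel[of l "a \<rhd>\<^bsub>l\<^esub> b" "ract B l a b" r] assms
  by (simp add: circ_ract_B)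

lemma braid_B_morphism: "dyn_morphism \<Lambda> (dyn_tensor \<Lambda> B B) (dyn_tensor \<Lambda> B B) (braid B)"
proof -
  have "braid B \<in> \<Lambda> \<rightarrow>\<^sub>E carrier A \<times> carrier A \<rightarrow>\<^sub>E carrier A \<times> carrier A"
    by (auto simp: post_to_braided_def Let_def split: if_splits)
  moreover have "braid B l (a, b) = (a \<rhd>\<^bsub>l\<^esub> b, ract B l a b)"
    if "l \<in> \<Lambda>" "a \<in> carrier A" "b \<in> carrier A" for l a b
    using that by (simp add: braid_B ract_B)
  ultimately show ?thesis
    by (auto simp: dyn_morphism_def dyn_tensor_def shift_ract_B)
qed

lemma rhd_circ_distrib:
  assumes "l \<in> \<Lambda>" "a \<in> carrier A" "x \<in> carrier A" "y \<in> carrier A"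
  shows "a \<rhd>\<^bsub>l\<^esub> circ S (l \<star> a) x y =
    circ S l (a \<rhd>\<^bsub>l\<^esub> x) (ract B l a x \<rhd>\<^bsub>l \<star> (a \<rhd>\<^bsub>l\<^esub> x)\<^esub> y)"
proof -
  have "a \<rhd>\<^bsub>l\<^esub> circ S (l \<star> a) x y = (a \<rhd>\<^bsub>l\<^esub> x) \<cdot>\<^bsub>l\<^esub> (circ S l a x \<rhd>\<^bsub>l\<^esub> y)"
    using assms by (simp add: circ_subadjacent rhd_dot rhd_rhd)
  also have "circ S l a x \<rhd>\<^bsub>l\<^esub> y = (a \<rhd>\<^bsub>l\<^esub> x) \<rhd>\<^bsub>l\<^esub> (ract B l a x \<rhd>\<^bsub>l \<star> (a \<rhd>\<^bsub>l\<^esub> x)\<^esub> y)"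
    using rhd_circ[of l "a \<rhd>\<^bsub>l\<^esub> x" "ract B l a x" y] assms by (simp add: circ_ract_B)
  finally show ?thesis
    using assms by (simp add: circ_subadjacent)
qed

text \<open>Condition (5): sliding \<open>a\<close> past \<open>x\<close> and then past
  \<open>y\<close> by (7) turns \<open>a \<circ> x \<circ> y\<close> into
  \<open>a \<rhd> (x \<circ> y)\<close> times the right-hand side.\<close>

lemma ract_B_circ_right:
  assumes "l \<in> \<Lambda>" "a \<in> carrier A" "x \<in> carrier A" "y \<in> carrier A"
  shows "ract B l a (circ S (l \<star> a) x y) = ract B (l \<star> (a \<rhd>\<^bsub>l\<^esub> x)) (ract B l a x) y"
proof (rule ract_B_eqI)
  let ?u = "a \<rhd>\<^bsub>l\<^esub> x" and ?r = "ract B l a x"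
  have "circ S l (a \<rhd>\<^bsub>l\<^esub> circ S (l \<star> a) x y) (ract B (l \<star> ?u) ?r y) =
        circ S l ?u (circ S (l \<star> ?u) (?r \<rhd>\<^bsub>l \<star> ?u\<^esub> y) (ract B (l \<star> ?u) ?r y))"
    using S.circ_assoc[of l ?u] assms by (simp add: rhd_circ_distrib)
  also have "\<dots> = circ S l (circ S l ?u ?r) y"
    using S.circ_assoc[of l ?u ?r y] assms by (simp add: circ_ract_B)
  also have "\<dots> = circ S l a (circ S (l \<star> a) x y)"
    using S.circ_assoc[of l a x y] assms by (simp add: circ_ract_B)
  finally show "circ S l (a \<rhd>\<^bsub>l\<^esub> circ S (l \<star> a) x y) (ract B (l \<star> ?u) ?r y) =
    circ S l a (circ S (l \<star> a) x y)" .
qed (use assms in auto)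

text \<open>Condition (6), by the same sliding: \<open>b\<close> is moved past \<open>x\<close>,
  then \<open>a\<close> past \<open>b \<rhd> x\<close>.\<close>

lemma ract_B_circ_left:
  assumes "l \<in> \<Lambda>" "a \<in> carrier A" "b \<in> carrier A" "x \<in> carrier A"
  shows "ract B l (circ S l a b) x =
    circ S (l \<star> (circ S l a b \<rhd>\<^bsub>l\<^esub> x)) (ract B l a (b \<rhd>\<^bsub>l \<star> a\<^esub> x)) (ract B (l \<star> a) b x)"
proof (rule ract_B_eqI)
  let ?v = "b \<rhd>\<^bsub>l \<star> a\<^esub> x"
  let ?w = "a \<rhd>\<^bsub>l\<^esub> ?v"
  have w: "circ S l a b \<rhd>\<^bsub>l\<^esub> x = ?w"
    using assms by (simp add: rhd_circ)
  have "circ S l ?w (circ S (l \<star> ?w) (ract B l a ?v) (ract B (l \<star> a) b x)) =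
        circ S l (circ S l a ?v) (ract B (l \<star> a) b x)"
    using S.circ_assoc[of l ?w "ract B l a ?v" "ract B (l \<star> a) b x"] assms
    by (simp add: circ_ract_B)
  also have "\<dots> = circ S l a (circ S (l \<star> a) b x)"
    using S.circ_assoc[of l a ?v "ract B (l \<star> a) b x"] assms by (simp add: circ_ract_B)
  also have "\<dots> = circ S l (circ S l a b) x"
    using S.circ_assoc[of l a b x] assms by simp
  finally show "circ S l (circ S l a b \<rhd>\<^bsub>l\<^esub> x) (circ S (l \<star> (circ S l a b \<rhd>\<^bsub>l\<^esub> x))
    (ract B l a ?v) (ract B (l \<star> a) b x)) = circ S l (circ S l a b) x"
    unfolding w .
qed (use assms in auto)

theorem braided_dynamical_group_post_to_braided: "braided_dynamical_group \<Lambda> B"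
proof -
  \<comment> \<open>Since \<open>a \<rhd> -\<close> fixes the unit, the criterion for condition (4)
    reduces to the two unit laws of \<open>\<circ>\<close>.\<close>
  have "ract B l a (unit_elt A) = a" if "l \<in> \<Lambda>" "a \<in> carrier A" for l a
    using that S.circ_neutral by (intro ract_B_eqI) auto
  then show ?thesis
    unfolding braided_dynamical_group_def
    using dynamical_group_B braid_B_morphism
    by (simp add: rhd_circ rhd_circ_distrib ract_B_circ_right ract_B_circ_left circ_ract_B)
qed

theorem braided_to_post_post_to_braided: "braided_to_post \<Lambda> B = A"
proof -
  \<comment> \<open>For \<open>i\<close> the \<open>\<circ>\<close>-inverse of \<open>a\<close>:
    \<open>a \<circ> (i \<rhd> b) = a \<cdot> (a \<rhd> (i \<rhd> b)) = a \<cdot> ((a \<circ> i)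
    \<rhd> b) = a \<cdot> b\<close>.\<close>
  have dot: "circ S l a (lact B (l \<star> a) (dyn_inv S l a) b) = a \<cdot>\<^bsub>l\<^esub> b"
    if "l \<in> \<Lambda>" "a \<in> carrier A" "b \<in> carrier A" for l a b
    using rhd_circ[of l a "dyn_inv S l a" b] S.circ_dyn_inv[of l a] that
    by (simp add: circ_subadjacent[of l a])
  \<comment> \<open>Equality of objects is strict: the computation above covers the carrier,
    extensionality the remaining arguments.\<close>
  have "dot (braided_to_post \<Lambda> B) = dot A"
  proof (rule PiE_ext)
    show "dot (braided_to_post \<Lambda> B) \<in> \<Lambda> \<rightarrow>\<^sub>E carrier A \<rightarrow>\<^sub>E carrier A \<rightarrow>\<^sub>E carrier A"
      using dot by (auto simp: braided_to_post_def dyn_inv_B)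
    show "dot A \<in> \<Lambda> \<rightarrow>\<^sub>E carrier A \<rightarrow>\<^sub>E carrier A \<rightarrow>\<^sub>E carrier A"
      by (rule dot_extensional)
    show "dot (braided_to_post \<Lambda> B) l = dot A l" if "l \<in> \<Lambda>" for l
      using dot that dot_extensional
      by (auto simp: braided_to_post_def dyn_inv_B fun_eq_iff PiE_iff extensional_def restrict_def)
  qed
  moreover have "rhd (braided_to_post \<Lambda> B) = rhd A"
    using rhd_extensional
    by (auto simp: braided_to_post_def fun_eq_iff PiE_iff extensional_def restrict_def)
  ultimately show ?thesis
    by (intro dyn_post_group.equality) (simp_all add: braided_to_post_def)
qed

end

section \<open>From braided dynamical groups to dynamical post-groups\<close>

locale braided_grp =
  fixes \<Lambda> :: "'l set" and G :: "('l, 'g) braided_dyn_group" (structure)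
  assumes braided_dynamical_group: "braided_dynamical_group \<Lambda> G"
begin

sublocale dyn_grp \<Lambda> G
  using braided_dynamical_group by unfold_locales (simp add: braided_dynamical_group_def)

abbreviation lact_at :: "'g \<Rightarrow> 'l \<Rightarrow> 'g \<Rightarrow> 'g" ("(_ \<rightharpoonup>\<^bsub>_\<^esub> _)" [73, 0, 72] 72)
  where "a \<rightharpoonup>\<^bsub>l\<^esub> b \<equiv> lact G l a b"

abbreviation ract_at :: "'g \<Rightarrow> 'l \<Rightarrow> 'g \<Rightarrow> 'g" ("(_ \<leftharpoonup>\<^bsub>_\<^esub> _)" [73, 0, 72] 72)
  where "a \<leftharpoonup>\<^bsub>l\<^esub> b \<equiv> ract G l a b"

lemma braid_morphism: "dyn_morphism \<Lambda> (dyn_tensor \<Lambda> G G) (dyn_tensor \<Lambda> G G) (braid G)"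
  using braided_dynamical_group unfolding braided_dynamical_group_def by auto

lemma braid_extensional:
  "braid G \<in> \<Lambda> \<rightarrow>\<^sub>E carrier G \<times> carrier G \<rightarrow>\<^sub>E carrier G \<times> carrier G"
  using braid_morphism unfolding dyn_morphism_def dyn_tensor_def by simp

lemma braid_closed:
  "\<lbrakk>l \<in> \<Lambda>; a \<in> carrier G; b \<in> carrier G\<rbrakk> \<Longrightarrow> braid G l (a, b) \<in> carrier G \<times> carrier G"
  using braid_extensional by (auto simp: PiE_iff)

lemma lact_closed [simp, intro]:
  "\<lbrakk>l \<in> \<Lambda>; a \<in> carrier G; b \<in> carrier G\<rbrakk> \<Longrightarrow> a \<rightharpoonup>\<^bsub>l\<^esub> b \<in> carrier G"
  using braid_closed[of l a b] by (auto simp: lact_def)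

lemma ract_closed [simp, intro]:
  "\<lbrakk>l \<in> \<Lambda>; a \<in> carrier G; b \<in> carrier G\<rbrakk> \<Longrightarrow> a \<leftharpoonup>\<^bsub>l\<^esub> b \<in> carrier G"
  using braid_closed[of l a b] by (auto simp: ract_def)

lemma neutral_lact [simp]: "\<lbrakk>l \<in> \<Lambda>; x \<in> carrier G\<rbrakk> \<Longrightarrow> \<e> \<rightharpoonup>\<^bsub>l\<^esub> x = x"
  using braided_dynamical_group unfolding braided_dynamical_group_def by blast

lemma ract_neutral [simp]: "\<lbrakk>l \<in> \<Lambda>; a \<in> carrier G\<rbrakk> \<Longrightarrow> a \<leftharpoonup>\<^bsub>l\<^esub> \<e> = a"
  using braided_dynamical_group unfolding braided_dynamical_group_def by blast

lemma circ_lact: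
  "\<lbrakk>l \<in> \<Lambda>; a \<in> carrier G; b \<in> carrier G; x \<in> carrier G\<rbrakk> \<Longrightarrow>
   (a \<circ>\<^bsub>l\<^esub> b) \<rightharpoonup>\<^bsub>l\<^esub> x = a \<rightharpoonup>\<^bsub>l\<^esub> (b \<rightharpoonup>\<^bsub>l \<star> a\<^esub> x)"
  using braided_dynamical_group unfolding braided_dynamical_group_def by blast

lemma lact_circ:
  "\<lbrakk>l \<in> \<Lambda>; a \<in> carrier G; x \<in> carrier G; y \<in> carrier G\<rbrakk> \<Longrightarrow>
   a \<rightharpoonup>\<^bsub>l\<^esub> (x \<circ>\<^bsub>l \<star> a\<^esub> y) = (a \<rightharpoonup>\<^bsub>l\<^esub> x) \<circ>\<^bsub>l\<^esub> ((a \<leftharpoonup>\<^bsub>l\<^esub> x) \<rightharpoonup>\<^bsub>l \<star> (a \<rightharpoonup>\<^bsub>l\<^esub> x)\<^esub> y)"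
  using braided_dynamical_group unfolding braided_dynamical_group_def by blast

lemma lact_circ_ract:
  "\<lbrakk>l \<in> \<Lambda>; a \<in> carrier G; b \<in> carrier G\<rbrakk> \<Longrightarrow> (a \<rightharpoonup>\<^bsub>l\<^esub> b) \<circ>\<^bsub>l\<^esub> (a \<leftharpoonup>\<^bsub>l\<^esub> b) = a \<circ>\<^bsub>l\<^esub> b"
  using braided_dynamical_group unfolding braided_dynamical_group_def by blast

section \<open>Invertibility of the left action\<close>

lemma lact_dyn_inv [simp]:
  "\<lbrakk>l \<in> \<Lambda>; a \<in> carrier G; x \<in> carrier G\<rbrakk> \<Longrightarrow> a \<rightharpoonup>\<^bsub>l\<^esub> (dyn_inv G l a \<rightharpoonup>\<^bsub>l \<star> a\<^esub> x) = x"
  using circ_lact[of l a "dyn_inv G l a" x] by simp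

lemma dyn_inv_lact [simp]:
  assumes "l \<in> \<Lambda>" "a \<in> carrier G" "x \<in> carrier G"
  shows "dyn_inv G l a \<rightharpoonup>\<^bsub>l \<star> a\<^esub> (a \<rightharpoonup>\<^bsub>l\<^esub> x) = x"
  using circ_lact[of "l \<star> a" "dyn_inv G l a" a x] assms by simp

lemma bij_lact:
  assumes "l \<in> \<Lambda>" "a \<in> carrier G"
  shows "bij_betw (lact G l a) (carrier G) (carrier G)"
  by (rule bij_betw_byWitness[where f' = "lact G (l \<star> a) (dyn_inv G l a)"]) (use assms in auto)

text \<open>Used as a change of variable: writing the second factor of \<open>dot P\<close> as
  \<open>a \<rightharpoonup> y\<close> eliminates the inverse, by \<open>dot_P_lact\<close>.\<close>

lemma lact_surj:
  assumes "l \<in> \<Lambda>" "a \<in> carrier G" "x \<in> carrier G"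
  obtains y where "y \<in> carrier G" "x = a \<rightharpoonup>\<^bsub>l\<^esub> y"
proof
  show "dyn_inv G l a \<rightharpoonup>\<^bsub>l \<star> a\<^esub> x \<in> carrier G"
    "x = a \<rightharpoonup>\<^bsub>l\<^esub> (dyn_inv G l a \<rightharpoonup>\<^bsub>l \<star> a\<^esub> x)"
    using assms by auto
qed

text \<open>Put \<open>u = a \<rightharpoonup>\<^sub>\<lambda> e\<close>. Condition (7) gives only \<open>u \<circ>\<^sub>\<lambda> a = a\<close>, where the second factor is
  taken at \<open>\<mu> = \<lambda> \<star> u\<close> and not at \<open>\<lambda>\<close>, so \<open>a\<close> cannot be cancelled. Instead one shows that \<open>u\<close>
  satisfies \<open>u \<rightharpoonup>\<^sub>\<lambda> e = u\<close>; then (7) gives \<open>u \<circ>\<^sub>\<lambda> u = u\<close>.\<close>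

lemma lact_neutral [simp]:
  assumes l: "l \<in> \<Lambda>" and a: "a \<in> carrier G"
  shows "a \<rightharpoonup>\<^bsub>l\<^esub> \<e> = \<e>"
proof -
  define u where "u = a \<rightharpoonup>\<^bsub>l\<^esub> \<e>"
  define m where "m = l \<star> u"
  define i where "i = dyn_inv G m a"
  have u: "u \<in> carrier G" and m: "m \<in> \<Lambda>" and i: "i \<in> carrier G"
    using l a by (auto simp: u_def m_def i_def)
  have ua: "u \<circ>\<^bsub>l\<^esub> a = a"
    using lact_circ_ract[of l a \<e>] l a by (simp add: u_def)
  have ma: "m \<star> a = l \<star> a"
    using shift_circ[of l u a] ua l a u by (simp add: m_def)
  \<comment> \<open>Condition (3) at \<open>x = y = \<e>\<close> reads
    \<open>u = u \<circ> (a \<rightharpoonup> \<e>)\<close> with the action taken at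
    \<open>m\<close>, so \<open>a\<close> fixes \<open>\<e>\<close> at the shifted
    parameter.\<close>
  have "u \<circ>\<^bsub>l\<^esub> (a \<rightharpoonup>\<^bsub>m\<^esub> \<e>) = u \<circ>\<^bsub>l\<^esub> \<e>"
    using lact_circ[of l a \<e> \<e>] l a by (simp add: u_def m_def)
  then have "a \<rightharpoonup>\<^bsub>m\<^esub> \<e> = \<e>"
    using circ_left_cancel[of l u "a \<rightharpoonup>\<^bsub>m\<^esub> \<e>" \<e>] l a u m by auto
  then have ie: "i \<rightharpoonup>\<^bsub>l \<star> a\<^esub> \<e> = \<e>"
    using dyn_inv_lact[of m a \<e>] m a ma by (simp add: i_def)
  \<comment> \<open>Multiplying \<open>u \<circ> a = a\<close> on the right by \<open>i\<close>, the
    inverse of \<open>a\<close> at \<open>m\<close> rather than at \<open>l\<close>, isolates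
    \<open>u\<close>.\<close>
  have "u = a \<circ>\<^bsub>l\<^esub> i"
    using circ_assoc[of l u a i] ua l a u m i by (simp add: m_def[symmetric] i_def)
  then have "u \<rightharpoonup>\<^bsub>l\<^esub> \<e> = u"
    using circ_lact[of l a i \<e>] ie l a i by (simp add: u_def)
  then have "u \<circ>\<^bsub>l\<^esub> u = u \<circ>\<^bsub>l\<^esub> \<e>"
    using lact_circ_ract[of l u \<e>] l u by simp
  then show ?thesis
    using circ_left_cancel[of l u u \<e>] l u by (simp add: u_def)
qed

section \<open>The post-group of a braided dynamical group\<close>

abbreviation P where "P \<equiv> braided_to_post \<Lambda> G"

lemma braided_to_post_simps [simp]:
  "carrier P = carrier G" "phi P = phi G" "unit_elt P = \<e>"
  by (simp_all add: braided_to_post_def)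

lemma rhd_P [simp]:
  "\<lbrakk>l \<in> \<Lambda>; a \<in> carrier G; b \<in> carrier G\<rbrakk> \<Longrightarrow> rhd P l a b = a \<rightharpoonup>\<^bsub>l\<^esub> b"
  by (simp add: braided_to_post_def)

lemma dot_P:
  "\<lbrakk>l \<in> \<Lambda>; a \<in> carrier G; b \<in> carrier G\<rbrakk> \<Longrightarrow>
   dot P l a b = a \<circ>\<^bsub>l\<^esub> (dyn_inv G l a \<rightharpoonup>\<^bsub>l \<star> a\<^esub> b)"
  by (simp add: braided_to_post_def)

lemma dot_P_closed [simp, intro]:
  "\<lbrakk>l \<in> \<Lambda>; a \<in> carrier G; b \<in> carrier G\<rbrakk> \<Longrightarrow> dot P l a b \<in> carrier G"
  by (simp add: dot_P)

lemma dot_P_lact [simp]: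
  "\<lbrakk>l \<in> \<Lambda>; a \<in> carrier G; b \<in> carrier G\<rbrakk> \<Longrightarrow> dot P l a (a \<rightharpoonup>\<^bsub>l\<^esub> b) = a \<circ>\<^bsub>l\<^esub> b"
  by (simp add: dot_P)

text \<open>For \<open>c = b \<rightharpoonup> d\<close>, condition (3) expands the left side to
  \<open>?u \<circ> (?r \<rightharpoonup> d)\<close>. By (7) and (2), \<open>a \<rightharpoonup> c =
  ?u \<rightharpoonup> (?r \<rightharpoonup> d)\<close>, so the right side is the same
  element.\<close>

lemma lact_dot_P:
  assumes l: "l \<in> \<Lambda>" and a: "a \<in> carrier G" and b: "b \<in> carrier G" and c: "c \<in> carrier G"
  shows "a \<rightharpoonup>\<^bsub>l\<^esub> dot P (l \<star> a) b c = dot P l (a \<rightharpoonup>\<^bsub>l\<^esub> b) (a \<rightharpoonup>\<^bsub>l\<^esub> c)"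
proof -
  obtain d where d: "d \<in> carrier G" "c = b \<rightharpoonup>\<^bsub>l \<star> a\<^esub> d"
    using lact_surj[of "l \<star> a" b c] assms by blast
  let ?u = "a \<rightharpoonup>\<^bsub>l\<^esub> b" and ?r = "a \<leftharpoonup>\<^bsub>l\<^esub> b"
  have "a \<rightharpoonup>\<^bsub>l\<^esub> c = ?u \<rightharpoonup>\<^bsub>l\<^esub> (?r \<rightharpoonup>\<^bsub>l \<star> ?u\<^esub> d)"
    using circ_lact[of l a b d] circ_lact[of l ?u ?r d] lact_circ_ract[of l a b] assms d by simp
  then have "dot P l ?u (a \<rightharpoonup>\<^bsub>l\<^esub> c) = ?u \<circ>\<^bsub>l\<^esub> (?r \<rightharpoonup>\<^bsub>l \<star> ?u\<^esub> d)"
    using assms d by simp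
  then show ?thesis
    using assms d by (simp add: lact_circ)
qed

text \<open>After substituting \<open>b = a \<rightharpoonup> b'\<close> and
  \<open>c = (a \<circ> b') \<rightharpoonup> c'\<close>, both bracketings become
  \<open>a \<circ> b' \<circ> c'\<close>.\<close>

lemma dot_P_assoc:
  assumes l: "l \<in> \<Lambda>" and a: "a \<in> carrier G" and b: "b \<in> carrier G" and c: "c \<in> carrier G"
  shows "dot P l a (dot P l b c) = dot P l (dot P l a b) c"
proof -
  obtain b' where b': "b' \<in> carrier G" "b = a \<rightharpoonup>\<^bsub>l\<^esub> b'"
    using lact_surj assms by blast
  obtain c' where c': "c' \<in> carrier G" "c = (a \<circ>\<^bsub>l\<^esub> b') \<rightharpoonup>\<^bsub>l\<^esub> c'"
    using lact_surj[of l "a \<circ>\<^bsub>l\<^esub> b'" c] assms b' by blast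
  \<comment> \<open>Distributivity pulls \<open>a \<rightharpoonup> -\<close> out of the inner
    product.\<close>
  have "dot P l b c = a \<rightharpoonup>\<^bsub>l\<^esub> (b' \<circ>\<^bsub>l \<star> a\<^esub> c')"
    using lact_dot_P[of l a b' "b' \<rightharpoonup>\<^bsub>l \<star> a\<^esub> c'"] assms b' c' by (simp add: circ_lact)
  then show ?thesis
    using assms b' c' by (simp add: circ_assoc)
qed

lemma constant_dynamical_group_P: "constant_dynamical_group \<Lambda> (post_group_dot \<Lambda> P)"
proof -
  have "dynamical_group \<Lambda> (post_group_dot \<Lambda> P)"
  proof (rule dynamical_group_if_right_inverses)
    show "circ (post_group_dot \<Lambda> P) \<in> \<Lambda> \<rightarrow>\<^sub>E carrier (post_group_dot \<Lambda> P) \<rightarrow>\<^sub>E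
        carrier (post_group_dot \<Lambda> P) \<rightarrow>\<^sub>E carrier (post_group_dot \<Lambda> P)"
      by (auto simp: post_group_dot_def braided_to_post_def)
  next
    fix l a assume "l \<in> \<Lambda>" "a \<in> carrier (post_group_dot \<Lambda> P)"
    then show "\<exists>b\<in>carrier (post_group_dot \<Lambda> P).
        circ (post_group_dot \<Lambda> P) l a b = neutral (post_group_dot \<Lambda> P)"
      \<comment> \<open>\<open>dot_P_lact\<close> turns the product with this witness into
        \<open>a \<circ> dyn_inv G l a\<close>.\<close>
      by (intro bexI[of _ "a \<rightharpoonup>\<^bsub>l\<^esub> dyn_inv G l a"]) (auto simp: post_group_dot_def)
  next
    fix l a assume la: "l \<in> \<Lambda>" "a \<in> carrier (post_group_dot \<Lambda> P)"
    \<comment> \<open>The identity \<open>a \<rightharpoonup> \<e> = \<e>\<close> makes the right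
      unit law an instance of \<open>dot_P_lact\<close>.\<close>
    then show "circ (post_group_dot \<Lambda> P) l a (neutral (post_group_dot \<Lambda> P)) = a"
      using dot_P_lact[of l a \<e>] by (simp add: post_group_dot_def)
    show "circ (post_group_dot \<Lambda> P) l (neutral (post_group_dot \<Lambda> P)) a = a"
      using dot_P_lact[of l \<e> a] la by (simp add: post_group_dot_def)
  qed (auto simp: post_group_dot_def dynamical_set_def dot_P_assoc)
  then show ?thesis
    by (simp add: constant_dynamical_group_def post_group_dot_def)
qed

theorem dynamical_post_group_braided_to_post: "dynamical_post_group \<Lambda> P"
proof -
  have "dynamical_set \<Lambda> P"
    using dynamical_group by (simp add: dynamical_group_def dynamical_set_def)
  moreover have "rhd P \<in> \<Lambda> \<rightarrow>\<^sub>E carrier P \<rightarrow>\<^sub>E carrier P \<rightarrow>\<^sub>E carrier P"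
    by (auto simp: braided_to_post_def)
  moreover have "bij_betw (rhd P l a) (carrier P) (carrier P)"
    if "l \<in> \<Lambda>" "a \<in> carrier P" for l a
    using bij_lact[of l a] bij_betw_cong[of "carrier G" "rhd P l a" "lact G l a"] that by simp
  \<comment> \<open>Through \<open>dot_P_lact\<close>, weighted associativity becomes condition (2),
    and the condition on \<open>phi\<close> becomes that of the dynamical group.\<close>
  ultimately show ?thesis
    unfolding dynamical_post_group_def
    using constant_dynamical_group_P by (simp add: lact_dot_P circ_lact)
qed

lemma circ_extensional: "circ G \<in> \<Lambda> \<rightarrow>\<^sub>E carrier G \<rightarrow>\<^sub>E carrier G \<rightarrow>\<^sub>E carrier G"
  using dynamical_group unfolding dynamical_group_def by auto

theorem post_to_braided_braided_to_post: "post_to_braided \<Lambda> P = G"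
proof -
  \<comment> \<open>On the carrier this is \<open>dot_P_lact\<close>; elsewhere both sides are
    \<open>undefined\<close>.\<close>
  have circ: "circ (subadjacent \<Lambda> P) = circ G"
    using circ_extensional
    by (auto simp: subadjacent_def fun_eq_iff PiE_iff extensional_def restrict_def)
  have simps: "carrier (subadjacent \<Lambda> P) = carrier G" "phi (subadjacent \<Lambda> P) = phi G"
      "neutral (subadjacent \<Lambda> P) = \<e>"
    by (simp_all add: subadjacent_def)
  have inv: "dyn_inv (subadjacent \<Lambda> P) = dyn_inv G"
    by (intro ext) (simp add: dyn_inv_def circ simps)
  \<comment> \<open>Condition (7), solved for the second component of the braiding.\<close>
  have ract: "dyn_inv G l (a \<rightharpoonup>\<^bsub>l\<^esub> b) \<circ>\<^bsub>l \<star> (a \<rightharpoonup>\<^bsub>l\<^esub> b)\<^esub> (a \<circ>\<^bsub>l\<^esub> b) = a \<leftharpoonup>\<^bsub>l\<^esub> b"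
    if "l \<in> \<Lambda>" "a \<in> carrier G" "b \<in> carrier G" for l a b
    using that lact_circ_ract[of l a b, symmetric] by simp
  have "braid (post_to_braided \<Lambda> P) = braid G"
    using braid_extensional
    by (auto simp: post_to_braided_def Let_def circ simps inv ract fun_eq_iff PiE_iff
        extensional_def restrict_def) (auto simp: lact_def ract_def)
  then show ?thesis
    by (intro braided_dyn_group.equality) (simp_all add: post_to_braided_def Let_def circ simps)
qed

end

section \<open>Morphisms and categories\<close>

lemma dyn_morphism_closed:
  "\<lbrakk>dyn_morphism \<Lambda> X Y f; l \<in> \<Lambda>; x \<in> carrier X\<rbrakk> \<Longrightarrow> f l x \<in> carrier Y"
  by (auto simp: dyn_morphism_def PiE_iff)

lemma dyn_morphism_phi:
  "\<lbrakk>dyn_morphism \<Lambda> X Y f; l \<in> \<Lambda>; x \<in> carrier X\<rbrakk> \<Longrightarrow> phi Y l (f l x) = phi X l x"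
  by (simp add: dyn_morphism_def)

lemma dyn_morphism_id: "dyn_morphism \<Lambda> X X (dyn_id \<Lambda> X)"
  by (auto simp: dyn_morphism_def dyn_id_def)

lemma dyn_morphism_comp:
  "\<lbrakk>dyn_morphism \<Lambda> X Y f; dyn_morphism \<Lambda> Y Z g\<rbrakk> \<Longrightarrow> dyn_morphism \<Lambda> X Z (dyn_comp \<Lambda> X g f)"
  by (auto simp: dyn_morphism_def dyn_comp_def PiE_iff)

text \<open>Extensionality of \<open>f\<close> makes these exact equalities: outside
  \<open>\<Lambda>\<close> and \<open>carrier X\<close> both sides are
  \<open>undefined\<close>.\<close>

lemma dyn_comp_id:
  assumes "dyn_morphism \<Lambda> X Y f"
  shows "dyn_comp \<Lambda> X f (dyn_id \<Lambda> X) = f" and "dyn_comp \<Lambda> X (dyn_id \<Lambda> Y) f = f"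
  using assms
  by (auto simp: dyn_morphism_def dyn_comp_def dyn_id_def fun_eq_iff PiE_iff extensional_def
      restrict_def)

text \<open>\<open>f\<close> maps into \<open>carrier X\<close>, where the restriction built into
  the inner \<open>dyn_comp\<close> on the right disappears.\<close>

lemma dyn_comp_assoc:
  "dyn_morphism \<Lambda> W X f \<Longrightarrow>
   dyn_comp \<Lambda> W h (dyn_comp \<Lambda> W g f) = dyn_comp \<Lambda> W (dyn_comp \<Lambda> X h g) f"
  by (auto simp: dyn_morphism_def dyn_comp_def fun_eq_iff PiE_iff restrict_def)

section \<open>Morphisms of post-groups and of braided groups\<close>

lemma post_group_hom_id:
  assumes "dynamical_post_group \<Lambda> A"
  shows "post_group_hom \<Lambda> A A (dyn_id \<Lambda> A)"
proof -
  interpret post_grp \<Lambda> A using assms by (rule post_grp.intro)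
  show ?thesis
    by (auto simp: post_group_hom_def dyn_morphism_id) (simp_all add: dyn_id_def)
qed

lemma post_group_hom_comp:
  assumes "dynamical_post_group \<Lambda> A" "post_group_hom \<Lambda> A B f" "post_group_hom \<Lambda> B C g"
  shows "post_group_hom \<Lambda> A C (dyn_comp \<Lambda> A g f)"
proof -
  interpret post_grp \<Lambda> A using assms(1) by (rule post_grp.intro)
  have f: "dyn_morphism \<Lambda> A B f" and g: "dyn_morphism \<Lambda> B C g"
    using assms by (auto simp: post_group_hom_def)
  \<comment> \<open>In the \<open>\<rhd>\<close> condition \<open>g\<close> is evaluated at
    \<open>phi B l (f l a)\<close>, which equals \<open>phi A l a\<close> because \<open>f\<close>
    is a morphism of dynamical sets.\<close>
  show ?thesis
    using assms dyn_morphism_comp[OF f g] dyn_morphism_closed[OF f] dyn_morphism_phi[OF f]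
    unfolding post_group_hom_def by (simp add: dyn_comp_def)
qed

lemma braided_group_hom_lact:
  "\<lbrakk>braided_group_hom \<Lambda> G H f; l \<in> \<Lambda>; a \<in> carrier G; b \<in> carrier G\<rbrakk> \<Longrightarrow>
   f l (lact G l a b) = lact H l (f l a) (f (phi G l a) b)"
  by (auto simp: braided_group_hom_def hom_square_def lact_def split_def prod_eq_iff)

text \<open>Compatibility with \<open>\<leftharpoonup>\<close> is automatic, by (7) and left cancellation.\<close>

lemma braided_group_homI:
  assumes "braided_dynamical_group \<Lambda> G" "braided_dynamical_group \<Lambda> H"
    and hom: "dyn_group_hom \<Lambda> G H f"
    and lact: "\<And>l a b. \<lbrakk>l \<in> \<Lambda>; a \<in> carrier G; b \<in> carrier G\<rbrakk> \<Longrightarrow>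
      f l (lact G l a b) = lact H l (f l a) (f (phi G l a) b)"
  shows "braided_group_hom \<Lambda> G H f"
proof -
  interpret G: braided_grp \<Lambda> G using assms(1) by (rule braided_grp.intro)
  interpret H: braided_grp \<Lambda> H using assms(2) by (rule braided_grp.intro)
  have f: "dyn_morphism \<Lambda> G H f"
    using hom by (simp add: dyn_group_hom_def)
  note fc [simp] = dyn_morphism_closed[OF f] and fp [simp] = dyn_morphism_phi[OF f]
  have circ: "f l (circ G l a b) = circ H l (f l a) (f (phi G l a) b)"
    if "l \<in> \<Lambda>" "a \<in> carrier G" "b \<in> carrier G" for l a b
    using hom that by (simp add: dyn_group_hom_def)
  have ract: "f (phi G l (lact G l a b)) (ract G l a b) = ract H l (f l a) (f (phi G l a) b)"
    if l: "l \<in> \<Lambda>" and a: "a \<in> carrier G" and b: "b \<in> carrier G" for l a b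
  proof (rule H.circ_left_cancel[where l = l and a = "f l (lact G l a b)"])
    have "circ H l (f l (lact G l a b)) (f (phi G l (lact G l a b)) (ract G l a b)) =
          f l (circ G l a b)"
      using circ[of l "lact G l a b" "ract G l a b"] G.lact_circ_ract[of l a b] l a b by simp
    also have "\<dots> = circ H l (f l (lact G l a b)) (ract H l (f l a) (f (phi G l a) b))"
      using H.lact_circ_ract[of l "f l a" "f (phi G l a) b"] l a b by (simp add: circ lact)
    finally show "circ H l (f l (lact G l a b)) (f (phi G l (lact G l a b)) (ract G l a b)) =
      circ H l (f l (lact G l a b)) (ract H l (f l a) (f (phi G l a) b))" .
  qed (use l a b in auto)
  show ?thesis
    unfolding braided_group_hom_def
  proof (intro conjI hom ballI, clarify)
    fix l a b assume "l \<in> \<Lambda>" "a \<in> carrier G" "b \<in> carrier G"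
    then show "hom_square G f l (braid G l (a, b)) = braid H l (hom_square G f l (a, b))"
      using lact[of l a b] ract[of l a b]
      by (simp add: hom_square_def lact_def ract_def split_def prod_eq_iff)
  qed
qed

lemma braided_group_hom_id:
  assumes "braided_dynamical_group \<Lambda> G"
  shows "braided_group_hom \<Lambda> G G (dyn_id \<Lambda> G)"
proof -
  interpret braided_grp \<Lambda> G using assms by (rule braided_grp.intro)
  have "dyn_group_hom \<Lambda> G G (dyn_id \<Lambda> G)"
    using dyn_morphism_id[of \<Lambda> G] by (simp add: dyn_group_hom_def) (simp add: dyn_id_def)
  then show ?thesis
    by (rule braided_group_homI[OF assms assms]) (simp add: dyn_id_def)
qed

lemma braided_group_hom_comp:
  assumes "braided_dynamical_group \<Lambda> G" "braided_dynamical_group \<Lambda> K"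
    and fh: "braided_group_hom \<Lambda> G H f" and gh: "braided_group_hom \<Lambda> H K g"
  shows "braided_group_hom \<Lambda> G K (dyn_comp \<Lambda> G g f)"
proof -
  interpret braided_grp \<Lambda> G using assms(1) by (rule braided_grp.intro)
  have f: "dyn_morphism \<Lambda> G H f" and g: "dyn_morphism \<Lambda> H K g"
    using fh gh by (auto simp: braided_group_hom_def dyn_group_hom_def)
  have "dyn_group_hom \<Lambda> G K (dyn_comp \<Lambda> G g f)"
    using fh gh dyn_morphism_comp[OF f g] dyn_morphism_closed[OF f] dyn_morphism_phi[OF f]
    unfolding braided_group_hom_def dyn_group_hom_def by (simp add: dyn_comp_def)
  then show ?thesis
    using braided_group_hom_lact[OF fh] braided_group_hom_lact[OF gh]
      dyn_morphism_closed[OF f] dyn_morphism_phi[OF f]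
    by (intro braided_group_homI[OF assms(1,2)]) (simp_all add: dyn_comp_def)
qed

section \<open>The categories of post-groups and of braided groups\<close>

lemma is_category_DPG: "is_category (DPG \<Lambda>)"
proof -
  have "dyn_morphism \<Lambda> A B f" if "post_group_hom \<Lambda> A B f" for A B f
    using that by (simp add: post_group_hom_def)
  then show ?thesis
    unfolding is_category_def DPG_def
    by (auto intro: post_group_hom_id post_group_hom_comp dyn_comp_id dyn_comp_assoc)
qed

lemma is_category_BDG: "is_category (BDG \<Lambda>)"
proof -
  have "dyn_morphism \<Lambda> G H f" if "braided_group_hom \<Lambda> G H f" for G H f
    using that by (simp add: braided_group_hom_def dyn_group_hom_def)
  then show ?thesis
    unfolding is_category_def BDG_def
    by (auto intro: braided_group_hom_id braided_group_hom_comp dyn_comp_id dyn_comp_assoc)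
qed

section \<open>Transfer of morphisms between the two structures\<close>

lemma braided_group_hom_post_to_braided:
  assumes "dynamical_post_group \<Lambda> A" "dynamical_post_group \<Lambda> A'"
    and hom: "post_group_hom \<Lambda> A A' f"
  shows "braided_group_hom \<Lambda> (post_to_braided \<Lambda> A) (post_to_braided \<Lambda> A') f"
proof -
  interpret A: post_grp \<Lambda> A using assms(1) by (rule post_grp.intro)
  interpret A': post_grp \<Lambda> A' using assms(2) by (rule post_grp.intro)
  have f: "dyn_morphism \<Lambda> A A' f"
    using hom by (simp add: post_group_hom_def)
  note [simp] = dyn_morphism_closed[OF f] dyn_morphism_phi[OF f]
  have rhd: "f l (rhd A l a b) = rhd A' l (f l a) (f (phi A l a) b)"
    and dot: "f l (dot A l a b) = dot A' l (f l a) (f l b)"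
    if "l \<in> \<Lambda>" "a \<in> carrier A" "b \<in> carrier A" for l a b
    using hom that by (auto simp: post_group_hom_def)
  \<comment> \<open>Applying \<open>f\<close> to \<open>a \<cdot> (a \<rhd> b)\<close> shifts the
    parameter only at the \<open>b\<close> inside \<open>\<rhd>\<close>, which is the homomorphism
    law for \<open>\<circ>\<close>.\<close>
  have "dyn_group_hom \<Lambda> A.B A'.B f"
    using f by (simp add: dyn_group_hom_def A.circ_subadjacent A'.circ_subadjacent dot rhd)
      (simp add: dyn_morphism_def)
  then show ?thesis
    by (rule braided_group_homI[OF A.braided_dynamical_group_post_to_braided
        A'.braided_dynamical_group_post_to_braided]) (simp add: rhd)
qed

lemma post_group_hom_braided_to_post:
  assumes "braided_dynamical_group \<Lambda> G" "braided_dynamical_group \<Lambda> H"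
    and hom: "braided_group_hom \<Lambda> G H f"
  shows "post_group_hom \<Lambda> (braided_to_post \<Lambda> G) (braided_to_post \<Lambda> H) f"
proof -
  interpret G: braided_grp \<Lambda> G using assms(1) by (rule braided_grp.intro)
  interpret H: braided_grp \<Lambda> H using assms(2) by (rule braided_grp.intro)
  have f: "dyn_morphism \<Lambda> G H f"
    using hom by (simp add: braided_group_hom_def dyn_group_hom_def)
  note [simp] = dyn_morphism_closed[OF f] dyn_morphism_phi[OF f]
  note lact = braided_group_hom_lact[OF hom]
  have dot: "f l (dot G.P l a b) = dot H.P l (f l a) (f l b)"
    if l: "l \<in> \<Lambda>" and a: "a \<in> carrier G" and b: "b \<in> carrier G" for l a b
  proof -
    \<comment> \<open>With \<open>b = a \<rightharpoonup> d\<close> the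
      \<open>\<cdot>\<close>-product is \<open>a \<circ> d\<close>, so preservation of
      \<open>\<cdot>\<close> reduces to preservation of \<open>\<circ>\<close> and
      \<open>\<rightharpoonup>\<close>.\<close>
    obtain d where d: "d \<in> carrier G" "b = lact G l a d"
      using G.lact_surj l a b by blast
    have "f l (circ G l a d) = circ H l (f l a) (f (phi G l a) d)"
      using hom l a d by (simp add: braided_group_hom_def dyn_group_hom_def)
    then show ?thesis
      using l a d by (simp add: lact)
  qed
  have "dyn_morphism \<Lambda> G.P H.P f"
    using f by (simp add: dyn_morphism_def)
  then show ?thesis
    by (simp add: post_group_hom_def dot lact)
qed

section \<open>The two functors and their composites\<close>

lemma is_functor_Y: "is_functor (DPG \<Lambda>) (BDG \<Lambda>) (functor_Y \<Lambda>)"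
proof -
  \<comment> \<open>Identities and composites in both categories depend only on
    \<open>\<Lambda>\<close> and the carrier, so the functor laws follow from the carrier being
    unchanged.\<close>
  have "carrier (post_to_braided \<Lambda> A) = carrier A" for A :: "('a, 'b) dyn_post_group"
    by (simp add: post_to_braided_def Let_def subadjacent_def)
  then show ?thesis
    unfolding is_functor_def
    using is_category_DPG[of \<Lambda>] is_category_BDG[of \<Lambda>]
    by (auto simp: DPG_def BDG_def functor_Y_def dyn_id_def dyn_comp_def
        intro: braided_group_hom_post_to_braided
          post_grp.braided_dynamical_group_post_to_braided post_grp.intro)
qed

lemma is_functor_P: "is_functor (BDG \<Lambda>) (DPG \<Lambda>) (functor_P \<Lambda>)"
proof -
  have "carrier (braided_to_post \<Lambda> G) = carrier G" for G :: "('a, 'b) braided_dyn_group"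
    by (simp add: braided_to_post_def)
  then show ?thesis
    unfolding is_functor_def
    using is_category_DPG[of \<Lambda>] is_category_BDG[of \<Lambda>]
    by (auto simp: DPG_def BDG_def functor_P_def dyn_id_def dyn_comp_def
        intro: post_group_hom_braided_to_post
          braided_grp.dynamical_post_group_braided_to_post braided_grp.intro)
qed

text \<open>Both functors fix arrows, so only the strict equality of objects
  \<open>braided_to_post_post_to_braided\<close> is at stake.\<close>

lemma functor_P_functor_Y: "composes_to_identity (DPG \<Lambda>) (functor_Y \<Lambda>) (functor_P \<Lambda>)"
  by (simp add: composes_to_identity_def DPG_def functor_Y_def functor_P_def
      post_grp.braided_to_post_post_to_braided post_grp.intro)

lemma functor_Y_functor_P: "composes_to_identity (BDG \<Lambda>) (functor_P \<Lambda>) (functor_Y \<Lambda>)"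
  by (simp add: composes_to_identity_def BDG_def functor_Y_def functor_P_def
      braided_grp.post_to_braided_braided_to_post braided_grp.intro)

theorem theorem4p15:
  fixes \<Lambda> :: "'l set"
    and \<D> :: "(('l, 'g) dyn_post_group, 'l \<Rightarrow> 'g \<Rightarrow> 'g) category"
    and \<B> :: "(('l, 'g) braided_dyn_group, 'l \<Rightarrow> 'g \<Rightarrow> 'g) category"
  assumes "\<D> = DPG \<Lambda>" and "\<B> = BDG \<Lambda>"
  shows "is_functor \<D> \<B> (functor_Y \<Lambda>) \<and>
         is_functor \<B> \<D> (functor_P \<Lambda>) \<and>
         composes_to_identity \<D> (functor_Y \<Lambda>) (functor_P \<Lambda>) \<and>
         composes_to_identity \<B> (functor_P \<Lambda>) (functor_Y \<Lambda>) \<and>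
         is_category_isomorphism \<D> \<B> (functor_Y \<Lambda>)"
  using assms is_functor_Y is_functor_P functor_P_functor_Y functor_Y_functor_P
  unfolding is_category_isomorphism_def by blast

end
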